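(* 1) There is an $L^e$-structure $\langle \mathcal{B}, e\rangle$ with $\langle \mathcal{B}, e\rangle \models Th(\mathbb{N}) + \mathrm{Exp}$ (where $\mathcal{A}$ denotes the substructure of $\mathcal{B}$ on whose universe $A$ the second argument of $e$ ranges), together with a set $E \subseteq A$ of exponents which is unbounded in $\mathcal{B}$ and a set $T \subseteq B^3$ of pairwise linearly independent triples $(a,b,c)$ which is unbounded in every coordinate, such that for every $n \in E$ and every $(a,b,c) \in T$, $$e(a,n) + e(b,n) = e(c,n).$$ Moreover: for every fixed $y \in A$, the function $x \mapsto e(x,y)$ is definable in $\mathcal{B}$; and $e$ is definable in the expansion $\langle \mathcal{B}, \mathcal{N}\rangle$ of $\mathcal{B}$ by a unary predicate $\mathcal{N}(x)$ expressing "$x$ is a standard natural number". 2) In this model there is a substructure $\langle \mathcal{A}, e\rangle \subseteq \langle \mathcal{B}, e\rangle$ such that $\mathcal{A}$ satisfies Presburger arithmetic, $e$ restricted to $A \times A$ is total with values in $A$, $E \subseteq A$ and $T \subseteq A^3$.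
   Context: $L = \langle 0,1,+,\cdot,\le\rangle$ is the language of arithmetic and $L^e = \langle 0,1,+,\cdot,e,\le\rangle$ with $e$ a binary (possibly partial) function symbol. $Th(\mathbb{N})$ is the complete $L$-theory of the standard model $\langle \mathbb{N},0,1,+,\cdot,\le\rangle$. In models of $I\Sigma_1$ (in particular of $Th(\mathbb{N})$) Gödel coding of formally finite sets and sequences is available; a set $X \subseteq B^n$ is "coded in $\mathcal{B}$" if some element $s\in B$ is, in $\mathcal{B}$, a set whose members are exactly the elements of $X$. Presburger arithmetic $\mathrm{Pr}$ is the theory with axioms: $0 \ne z+1$; $x\neq 0 \to \exists z\,(x = z+1)$; $x+z=y+z\to x=y$; $x+0=x$; associativity and commutativity of $+$; $x\le y \leftrightarrow \exists z\,(x+z=y)$; and for each standard $0<n\in\mathbb{N}$, $\exists y\,(ny \le x < n(y+1))$ (here $ny$ abbreviates $y+\dots+y$). $\mathrm{Exp}$ is the set of axioms (e0)–(e7) for $\langle\mathcal{B},e\rangle$: (e0) there is an $L$-substructure $\mathcal{A}$ of $\mathcal{B}$ (with universe $A$) satisfying all axioms of $\mathrm{Pr}$ such that $e : B \times A \to B$; and for all $x \in B$, $y,z \in A$ and every sequence $(x_i)_{i<l}$ coded in $\mathcal{B}$ with $l\in B$: (e1) $(x=1 \vee y=0) \leftrightarrow e(x,y)=1$; (e2) $x \ne 0 \to e(x,y)\neq 0$; (e3) $e(x,1)=x$; (e4) $e(x,y+z)=e(x,y)\cdot e(x,z)$; (e5) $e(\prod_{i<l} x_i, y) = \prod_{i<l}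 e(x_i,y)$ (the product on the right computed in $\mathcal{B}$, which makes sense by (e7)); (e6) $e(e(x,y),z) = e(x,yz)$; (e7) for every $b\in B$, the set $\{(x,e(x,y)) : x<b\}$ is coded in $\mathcal{B}$. A set $T\subseteq B^3$ is unbounded in every coordinate if for each coordinate $i\in\{1,2,3\}$ and each $b\in B$ some triple in $T$ has $i$-th coordinate $>b$. Two elements $a,b$ are linearly independent if there are no standard integers $m,n$, not both zero, with $ma = nb$. *)

theory Defs
  imports Main "HOL-Library.Nat_Bijection"
begin

datatype tm = Var nat | Zero | One | Plus tm tm | Times tm tm

text \<open>The constructor Pred is the extra unary predicate symbol (used only for the
  expansion of a model by the predicate N "is standard"); pure formulas are L-formulas.\<close>
datatype fm = Eq tm tm | Leq tm tm | Pred tm | Neg fm | Conj fm fm | Ex nat fm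

record 'a lstr =
  carr :: "'a set"
  zero_s :: 'a
  one_s :: 'a
  plus_s :: "'a \<Rightarrow> 'a \<Rightarrow> 'a"
  times_s :: "'a \<Rightarrow> 'a \<Rightarrow> 'a"
  le_s :: "'a \<Rightarrow> 'a \<Rightarrow> bool"

fun teval :: "'a lstr \<Rightarrow> (nat \<Rightarrow> 'a) \<Rightarrow> tm \<Rightarrow> 'a" where
  "teval S v (Var i) = v i"
| "teval S v Zero = zero_s S"
| "teval S v One = one_s S"
| "teval S v (Plus s t) = plus_s S (teval S v s) (teval S v t)"
| "teval S v (Times s t) = times_s S (teval S v s) (teval S v t)"

fun sat :: "'a lstr \<Rightarrow> 'a set \<Rightarrow> (nat \<Rightarrow> 'a) \<Rightarrow> fm \<Rightarrow> bool" where
  "sat S P v (Eq s t) = (teval S v s = teval S v t)"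
| "sat S P v (Leq s t) = le_s S (teval S v s) (teval S v t)"
| "sat S P v (Pred t) = (teval S v t \<in> P)"
| "sat S P v (Neg \<phi>) = (\<not> sat S P v \<phi>)"
| "sat S P v (Conj \<phi> \<psi>) = (sat S P v \<phi> \<and> sat S P v \<psi>)"
| "sat S P v (Ex x \<phi>) = (\<exists>a\<in>carr S. sat S P (v(x := a)) \<phi>)"

fun pure :: "fm \<Rightarrow> bool" where
  "pure (Pred t) = False"
| "pure (Neg \<phi>) = pure \<phi>"
| "pure (Conj \<phi> \<psi>) = (pure \<phi> \<and> pure \<psi>)"
| "pure (Ex x \<phi>) = pure \<phi>"
| "pure _ = True"

fun tvars :: "tm \<Rightarrow> nat set" where
  "tvars (Var i) = {i}"
| "tvars Zero = {}"
| "tvars One = {}"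
| "tvars (Plus s t) = tvars s \<union> tvars t"
| "tvars (Times s t) = tvars s \<union> tvars t"

fun fvars :: "fm \<Rightarrow> nat set" where
  "fvars (Eq s t) = tvars s \<union> tvars t"
| "fvars (Leq s t) = tvars s \<union> tvars t"
| "fvars (Pred t) = tvars t"
| "fvars (Neg \<phi>) = fvars \<phi>"
| "fvars (Conj \<phi> \<psi>) = fvars \<phi> \<union> fvars \<psi>"
| "fvars (Ex x \<phi>) = fvars \<phi> - {x}"

definition is_lstr :: "'a lstr \<Rightarrow> bool" where
  "is_lstr S \<longleftrightarrow> zero_s S \<in> carr S \<and> one_s S \<in> carr S \<and>
     (\<forall>x\<in>carr S. \<forall>y\<in>carr S. plus_s S x y \<in> carr S \<and> times_s S x y \<in> carr S)"

definition natS :: "nat lstr" where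
  "natS = \<lparr>carr = UNIV, zero_s = 0, one_s = 1, plus_s = (+), times_s = (*), le_s = (\<le>)\<rparr>"

definition ThN :: "fm set" where
  "ThN = {\<phi>. pure \<phi> \<and> fvars \<phi> = {} \<and> sat natS {} (\<lambda>_. 0) \<phi>}"

definition models :: "'a lstr \<Rightarrow> fm set \<Rightarrow> bool" where
  "models S Th \<longleftrightarrow> (\<forall>\<phi>\<in>Th. \<forall>v. range v \<subseteq> carr S \<longrightarrow> sat S {} v \<phi>)"

definition asg :: "'a list \<Rightarrow> (nat \<Rightarrow> 'a) \<Rightarrow> nat \<Rightarrow> 'a" where
  "asg xs w i = (if i < length xs then xs ! i else w i)"

definition L_definable :: "'a lstr \<Rightarrow> nat \<Rightarrow> 'a list set \<Rightarrow> bool" where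
  "L_definable S k R \<longleftrightarrow> (\<exists>\<phi> w. pure \<phi> \<and> range w \<subseteq> carr S \<and>
     (\<forall>xs. length xs = k \<and> set xs \<subseteq> carr S \<longrightarrow> (xs \<in> R \<longleftrightarrow> sat S {} (asg xs w) \<phi>)))"

definition nmul :: "'a lstr \<Rightarrow> nat \<Rightarrow> 'a \<Rightarrow> 'a" where
  "nmul S n y = (plus_s S y ^^ n) (zero_s S)"

definition stdN :: "'a lstr \<Rightarrow> 'a set" where
  "stdN S = range (\<lambda>k. nmul S k (one_s S))"

definition N_definable :: "'a lstr \<Rightarrow> nat \<Rightarrow> 'a list set \<Rightarrow> bool" where
  "N_definable S k R \<longleftrightarrow> (\<exists>\<phi> w. range w \<subseteq> carr S \<and>
     (\<forall>xs. length xs = k \<and> set xs \<subseteq> carr S \<longrightarrow> (xs \<in> R \<longleftrightarrow> sat S (stdN S) (asg xs w) \<phi>)))"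

definition defines_in_N :: "nat \<Rightarrow> nat list set \<Rightarrow> fm \<Rightarrow> bool" where
  "defines_in_N k R \<phi> \<longleftrightarrow> pure \<phi> \<and> fvars \<phi> \<subseteq> {..<k} \<and>
     (\<forall>xs::nat list. length xs = k \<longrightarrow> (xs \<in> R \<longleftrightarrow> sat natS {} (asg xs (\<lambda>_. 0)) \<phi>))"

text \<open>Interpretation in S of an (arithmetically definable) relation R on N, via a
  parameter-free L-formula defining R in N (independent of the choice when S |= Th(N)).\<close>
definition ext :: "'a lstr \<Rightarrow> nat \<Rightarrow> nat list set \<Rightarrow> 'a list set" where
  "ext S k R = {xs. length xs = k \<and> set xs \<subseteq> carr S \<and>
     sat S {} (asg xs (\<lambda>_. zero_s S)) (SOME \<phi>. defines_in_N k R \<phi>)}"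

text \<open>Ackermann membership: x is in the set coded by s.\<close>
definition memN :: "nat list set" where
  "memN = {[x, s] | x s. odd (s div 2 ^ x)}"

definition tupN :: "nat \<Rightarrow> nat list set" where
  "tupN n = {xs @ [list_encode xs] | xs. length xs = n}"

definition lenN :: "nat list set" where
  "lenN = {[s, l] | s l. length (list_decode s) = l}"

definition nthN :: "nat list set" where
  "nthN = {[s, i, x] | s i x. i < length (list_decode s) \<and> list_decode s ! i = x}"

definition prodN :: "nat list set" where
  "prodN = {[s, p] | s p. p = prod_list (list_decode s)}"

definition coded_set :: "'a lstr \<Rightarrow> nat \<Rightarrow> 'a list set \<Rightarrow> bool" where
  "coded_set S n X \<longleftrightarrow> (\<exists>s\<in>carr S. X = {xs. length xs = n \<and> set xs \<subseteq> carr S \<and>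
      (\<exists>c. xs @ [c] \<in> ext S (Suc n) (tupN n) \<and> [c, s] \<in> ext S 2 memN)})"

definition lt_s :: "'a lstr \<Rightarrow> 'a \<Rightarrow> 'a \<Rightarrow> bool" where
  "lt_s S x y \<longleftrightarrow> le_s S x y \<and> x \<noteq> y"

definition substr :: "'a lstr \<Rightarrow> 'a set \<Rightarrow> bool" where
  "substr S A \<longleftrightarrow> A \<subseteq> carr S \<and> zero_s S \<in> A \<and> one_s S \<in> A \<and>
     (\<forall>x\<in>A. \<forall>y\<in>A. plus_s S x y \<in> A \<and> times_s S x y \<in> A)"

definition presburger :: "'a lstr \<Rightarrow> 'a set \<Rightarrow> bool" where
  "presburger S A \<longleftrightarrow>
     (\<forall>z\<in>A. zero_s S \<noteq> plus_s S z (one_s S)) \<and>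
     (\<forall>x\<in>A. x \<noteq> zero_s S \<longrightarrow> (\<exists>z\<in>A. x = plus_s S z (one_s S))) \<and>
     (\<forall>x\<in>A. \<forall>y\<in>A. \<forall>z\<in>A. plus_s S x z = plus_s S y z \<longrightarrow> x = y) \<and>
     (\<forall>x\<in>A. plus_s S x (zero_s S) = x) \<and>
     (\<forall>x\<in>A. \<forall>y\<in>A. \<forall>z\<in>A. plus_s S (plus_s S x y) z = plus_s S x (plus_s S y z)) \<and>
     (\<forall>x\<in>A. \<forall>y\<in>A. plus_s S x y = plus_s S y x) \<and>
     (\<forall>x\<in>A. \<forall>y\<in>A. le_s S x y \<longleftrightarrow> (\<exists>z\<in>A. plus_s S x z = y)) \<and>
     (\<forall>n::nat. n > 0 \<longrightarrow> (\<forall>x\<in>A. \<exists>y\<in>A.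
         le_s S (nmul S n y) x \<and> lt_s S x (nmul S n (plus_s S y (one_s S)))))"

definition Exp :: "'a lstr \<Rightarrow> 'a set \<Rightarrow> ('a \<Rightarrow> 'a \<Rightarrow> 'a) \<Rightarrow> bool" where
  "Exp S A e \<longleftrightarrow>
     \<comment> \<open>(e0)\<close>
     substr S A \<and> presburger S A \<and> (\<forall>x\<in>carr S. \<forall>y\<in>A. e x y \<in> carr S) \<and>
     \<comment> \<open>(e1)\<close>
     (\<forall>x\<in>carr S. \<forall>y\<in>A. (x = one_s S \<or> y = zero_s S) \<longleftrightarrow> e x y = one_s S) \<and>
     \<comment> \<open>(e2)\<close>
     (\<forall>x\<in>carr S. \<forall>y\<in>A. x \<noteq> zero_s S \<longrightarrow> e x y \<noteq> zero_s S) \<and>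
     \<comment> \<open>(e3)\<close>
     (\<forall>x\<in>carr S. e x (one_s S) = x) \<and>
     \<comment> \<open>(e4)\<close>
     (\<forall>x\<in>carr S. \<forall>y\<in>A. \<forall>z\<in>A. e x (plus_s S y z) = times_s S (e x y) (e x z)) \<and>
     \<comment> \<open>(e5): s codes (x_i)_{i<l}, s' codes (e(x_i,y))_{i<l}, p, p' their products in S\<close>
     (\<forall>s\<in>carr S. \<forall>l\<in>carr S. \<forall>y\<in>A. \<forall>s'\<in>carr S. \<forall>p\<in>carr S. \<forall>p'\<in>carr S.
        [s, l] \<in> ext S 2 lenN \<and> [s', l] \<in> ext S 2 lenN \<and>
        (\<forall>i\<in>carr S. \<forall>x\<in>carr S. lt_s S i l \<and> [s, i, x] \<in> ext S 3 nthN
            \<longrightarrow> [s', i, e x y] \<in> ext S 3 nthN) \<and>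
        [s, p] \<in> ext S 2 prodN \<and> [s', p'] \<in> ext S 2 prodN
        \<longrightarrow> e p y = p') \<and>
     \<comment> \<open>(e6)\<close>
     (\<forall>x\<in>carr S. \<forall>y\<in>A. \<forall>z\<in>A. e (e x y) z = e x (times_s S y z)) \<and>
     \<comment> \<open>(e7)\<close>
     (\<forall>b\<in>carr S. \<forall>y\<in>A. coded_set S 2 {[x, e x y] | x. x \<in> carr S \<and> lt_s S x b})"

definition lin_indep :: "'a lstr \<Rightarrow> 'a \<Rightarrow> 'a \<Rightarrow> bool" where
  "lin_indep S a b \<longleftrightarrow> \<not> (\<exists>m n::nat. (m \<noteq> 0 \<or> n \<noteq> 0) \<and> nmul S m a = nmul S n b)"

end

theory Submission
  imports Defs "HOL-Number_Theory.Number_Theory" Complex_Main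
begin

text \<open>
  Let B be an ultrapower of the natural numbers along a free ultrafilter on the naturals. A homomorphism
  from a discretely ordered ring to B cannot take a nonstandard exponent to a standard one, so
  exponents must act nontrivially on the exponent vectors (v_p(x)) of the bases. With P a rational
  idempotent matrix on exponent vectors, and I an ideal of the ring of B whose members are
  divisible by every standard number, the exponent y = s + k (s in I, k a standard integer) acts as
  k + sP. This is a ring action since (k + sP)(l + tP) = kl + (st + kt + ls)P.

  The matrix P fixes the primes not dividing G and sends a prime p dividing G to w_p / D times the
  exponent vector of G, where D is the weighted number phi(G) of prime factors of G; thus
  e(x, y) = x^y G^(phi(x) s / D) / x_1^s with x_1 the part of x composed of primes dividing G.
  Taking G = a * 3 * (a + 3) and weights with phi(a) = phi(3) = phi(a + 3), P does not distinguish
  a, 3 and a + 3, so e(a, 1 + s) = aq, e(3, 1 + s) = 3q and e(a + 3, 1 + s) = (a + 3)q for one and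
  the same q: the Fermat equation becomes the identity a + 3 = a + 3. Multiples of this triple
  by members of I are unbounded.

  The number a is divisible by all standard primes except 3 and 5, and 5 divides a + 3. Hence all
  standard primes divide G, and I can be taken to be the intersection of the ideals generated by the
  standard powers of G. If x = k + s is an exponent coprime to G, then k is 1 or -1 and
  e(x, y) = x^y is congruent to 1 or -1 modulo I; otherwise e(x, y) lies in I for nonstandard y.
  So the exponents are closed under e.
\<close>

section \<open>Renaming variables\<close>

lemma teval_cong: "(\<And>i. i \<in> tvars t \<Longrightarrow> v i = w i) \<Longrightarrow> teval S v t = teval S w t"
  by (induction t) auto

lemma sat_cong: "(\<And>i. i \<in> fvars \<phi> \<Longrightarrow> v i = w i) \<Longrightarrow> sat S P v \<phi> \<longleftrightarrow> sat S P w \<phi>"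
proof (induction \<phi> arbitrary: v w)
  case (Eq s t)
  then show ?case using teval_cong[of s v w] teval_cong[of t v w] by auto
next
  case (Leq s t)
  then show ?case using teval_cong[of s v w] teval_cong[of t v w] by auto
next
  case (Pred t)
  then show ?case using teval_cong[of t v w] by auto
next
  case (Conj \<phi> \<psi>)
  have "sat S P v \<phi> \<longleftrightarrow> sat S P w \<phi>" "sat S P v \<psi> \<longleftrightarrow> sat S P w \<psi>"
    using Conj.prems by (auto intro!: Conj.IH)
  then show ?case by simp
next
  case (Ex x \<phi>)
  have "sat S P (v(x := a)) \<phi> \<longleftrightarrow> sat S P (w(x := a)) \<phi>" for a
    using Ex.prems by (intro Ex.IH) auto
  then show ?case by simp
next
  case (Neg \<phi>)
  have "sat S P v \<phi> \<longleftrightarrow> sat S P w \<phi>" using Neg.prems by (intro Neg.IH) auto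
  then show ?case by simp
qed

lemma finite_tvars [simp]: "finite (tvars t)"
  by (induction t) auto

lemma finite_fvars [simp]: "finite (fvars \<phi>)"
  by (induction \<phi>) auto

lemma fvars_bound: "\<exists>N. fvars \<phi> \<subseteq> {..<N}"
  using finite_nat_iff_bounded[of "fvars \<phi>"] by simp

primrec rename_tm :: "(nat \<Rightarrow> nat) \<Rightarrow> tm \<Rightarrow> tm" where
  "rename_tm \<sigma> (Var i) = Var (\<sigma> i)"
| "rename_tm \<sigma> Zero = Zero"
| "rename_tm \<sigma> One = One"
| "rename_tm \<sigma> (Plus s t) = Plus (rename_tm \<sigma> s) (rename_tm \<sigma> t)"
| "rename_tm \<sigma> (Times s t) = Times (rename_tm \<sigma> s) (rename_tm \<sigma> t)"

text \<open>Lies above the images of all free variables, so that a bound variable moved here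
  captures none of them; inserting 0 keeps \<open>Max\<close> off the empty set.\<close>

definition fresh :: "(nat \<Rightarrow> nat) \<Rightarrow> fm \<Rightarrow> nat" where
  "fresh \<sigma> \<phi> = Suc (Max (insert 0 (\<sigma> ` fvars \<phi>)))"

primrec rename_fm :: "(nat \<Rightarrow> nat) \<Rightarrow> fm \<Rightarrow> fm" where
  "rename_fm \<sigma> (Eq s t) = Eq (rename_tm \<sigma> s) (rename_tm \<sigma> t)"
| "rename_fm \<sigma> (Leq s t) = Leq (rename_tm \<sigma> s) (rename_tm \<sigma> t)"
| "rename_fm \<sigma> (Pred t) = Pred (rename_tm \<sigma> t)"
| "rename_fm \<sigma> (Neg \<phi>) = Neg (rename_fm \<sigma> \<phi>)"
| "rename_fm \<sigma> (Conj \<phi> \<psi>) = Conj (rename_fm \<sigma> \<phi>) (rename_fm \<sigma> \<psi>)"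
| "rename_fm \<sigma> (Ex x \<phi>) = Ex (fresh \<sigma> (Ex x \<phi>)) (rename_fm (\<sigma>(x := fresh \<sigma> (Ex x \<phi>))) \<phi>)"

lemma fresh_neq: "i \<in> fvars \<phi> \<Longrightarrow> \<sigma> i \<noteq> fresh \<sigma> \<phi>"
proof -
  assume "i \<in> fvars \<phi>"
  then have "\<sigma> i \<le> Max (insert 0 (\<sigma> ` fvars \<phi>))" by (intro Max_ge) auto
  then show ?thesis unfolding fresh_def by linarith
qed

lemma teval_rename: "teval S v (rename_tm \<sigma> t) = teval S (v \<circ> \<sigma>) t"
  by (induction t) auto

text \<open>Bound variables move to fresh ones, so \<open>\<sigma>\<close> may identify variables.
  Later this allows irrelevant variables to be sent to 0.\<close>

lemma sat_rename: "sat S P v (rename_fm \<sigma> \<phi>) \<longleftrightarrow> sat S P (v \<circ> \<sigma>) \<phi>"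
proof (induction \<phi> arbitrary: v \<sigma>)
  case (Ex x \<phi>)
  let ?y = "fresh \<sigma> (Ex x \<phi>)"
  have "sat S P (v(?y := a) \<circ> \<sigma>(x := ?y)) \<phi> \<longleftrightarrow> sat S P ((v \<circ> \<sigma>)(x := a)) \<phi>" for a
  proof (rule sat_cong)
    fix i assume "i \<in> fvars \<phi>"
    then show "(v(?y := a) \<circ> \<sigma>(x := ?y)) i = ((v \<circ> \<sigma>)(x := a)) i"
      using fresh_neq[of i "Ex x \<phi>" \<sigma>] by auto
  qed
  then show ?case by (simp only: rename_fm.simps sat.simps Ex.IH)
qed (auto simp: teval_rename)

lemma pure_rename: "pure (rename_fm \<sigma> \<phi>) = pure \<phi>"
  by (induction \<phi> arbitrary: \<sigma>) auto

lemma tvars_rename: "tvars (rename_tm \<sigma> t) = \<sigma> ` tvars t"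
  by (induction t) auto

lemma fvars_rename: "fvars (rename_fm \<sigma> \<phi>) \<subseteq> \<sigma> ` fvars \<phi>"
proof (induction \<phi> arbitrary: \<sigma>)
  case (Ex x \<phi>)
  let ?y = "fresh \<sigma> (Ex x \<phi>)"
  have "fvars (rename_fm (\<sigma>(x := ?y)) \<phi>) \<subseteq> \<sigma>(x := ?y) ` fvars \<phi>" by (rule Ex.IH)
  then show ?case by (auto split: if_splits)
next
  case (Conj \<phi> \<psi>)
  show ?case using Conj.IH[of \<sigma>] by auto
qed (auto simp: tvars_rename)

section \<open>Arithmetical relations and functions\<close>

text \<open>Predicates on environments instead of formulas: definability of a relation then follows
  from closure properties, without a formula being written down.\<close>

definition arithP :: "((nat \<Rightarrow> nat) \<Rightarrow> bool) \<Rightarrow> bool" where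
  "arithP P \<longleftrightarrow> (\<exists>\<phi>. pure \<phi> \<and> (\<forall>v. sat natS {} v \<phi> \<longleftrightarrow> P v))"

definition arithF :: "((nat \<Rightarrow> nat) \<Rightarrow> nat) \<Rightarrow> bool" where
  "arithF F \<longleftrightarrow> arithP (\<lambda>v. v 0 = F (\<lambda>i. v (Suc i)))"

lemma natS_simps [simp]:
  "carr natS = UNIV" "zero_s natS = 0" "one_s natS = 1"
  "plus_s natS = (+)" "times_s natS = (*)" "le_s natS = (\<le>)"
  by (auto simp: natS_def)

lemma arithP_rename:
  assumes "arithP P"
  shows "arithP (\<lambda>v. P (\<lambda>i. v (\<sigma> i)))"
proof -
  obtain \<phi> where "pure \<phi>" "\<forall>v. sat natS {} v \<phi> \<longleftrightarrow> P v" using assms by (auto simp: arithP_def)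
  then show ?thesis
    unfolding arithP_def
    by (intro exI[of _ "rename_fm \<sigma> \<phi>"]) (auto simp: pure_rename sat_rename o_def)
qed

lemma arithP_not:
  assumes "arithP P"
  shows "arithP (\<lambda>v. \<not> P v)"
proof -
  obtain \<phi> where "pure \<phi>" "\<forall>v. sat natS {} v \<phi> \<longleftrightarrow> P v" using assms by (auto simp: arithP_def)
  then show ?thesis
    unfolding arithP_def by (intro exI[of _ "Neg \<phi>"]) simp
qed

lemma arithP_conj:
  assumes "arithP P" "arithP Q"
  shows "arithP (\<lambda>v. P v \<and> Q v)"
proof -
  obtain \<phi> \<psi> where "pure \<phi>" "\<forall>v. sat natS {} v \<phi> \<longleftrightarrow> P v" "pure \<psi>" "\<forall>v. sat natS {} v \<psi> \<longleftrightarrow> Q v"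
    using assms by (auto simp: arithP_def)
  then show ?thesis
    unfolding arithP_def by (intro exI[of _ "Conj \<phi> \<psi>"]) simp
qed

lemma arithP_disj:
  assumes "arithP P" "arithP Q"
  shows "arithP (\<lambda>v. P v \<or> Q v)"
  using arithP_not[OF arithP_conj[OF assms[THEN arithP_not]]] by (simp only: de_Morgan_conj not_not)

lemma arithP_imp: "arithP P \<Longrightarrow> arithP Q \<Longrightarrow> arithP (\<lambda>v. P v \<longrightarrow> Q v)"
  unfolding imp_conv_disj by (intro arithP_disj arithP_not)

lemma arithP_ex_upd:
  assumes "arithP P"
  shows "arithP (\<lambda>v. \<exists>a. P (v(x := a)))"
proof -
  obtain \<phi> where "pure \<phi>" "\<forall>v. sat natS {} v \<phi> \<longleftrightarrow> P v" using assms by (auto simp: arithP_def)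
  then show ?thesis
    unfolding arithP_def by (intro exI[of _ "Ex x \<phi>"]) auto
qed

text \<open>A formula has finitely many free variables. The bound N leaves room for quantified
  witnesses and for substitution.\<close>

lemma arithP_support:
  assumes "arithP P"
  obtains N where "\<And>v w. (\<And>i. i < N \<Longrightarrow> v i = w i) \<Longrightarrow> P v \<longleftrightarrow> P w"
proof -
  obtain \<phi> where \<phi>: "\<forall>v. sat natS {} v \<phi> \<longleftrightarrow> P v" using assms by (auto simp: arithP_def)
  obtain N where "fvars \<phi> \<subseteq> {..<N}" using fvars_bound by blast
  then have "P v \<longleftrightarrow> P w" if "\<And>i. i < N \<Longrightarrow> v i = w i" for v w
    using sat_cong[of \<phi> v w natS "{}"] that \<phi> by auto
  then show ?thesis by (rule that)
qed

text \<open>Environments are read in de Bruijn style: a quantifier pushes its witness in front.\<close>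
lemma arithP_ex:
  assumes "arithP (\<lambda>v. Q (v 0) (\<lambda>i. v (Suc i)))"
  shows "arithP (\<lambda>v. \<exists>a. Q a v)"
proof -
  obtain N where N: "\<And>v w. (\<And>i. i < N \<Longrightarrow> v i = w i) \<Longrightarrow> 
      Q (v 0) (\<lambda>i. v (Suc i)) \<longleftrightarrow> Q (w 0) (\<lambda>i. w (Suc i))"
    using arithP_support[OF assms] by blast
  let ?\<sigma> = "\<lambda>i. case i of 0 \<Rightarrow> N | Suc j \<Rightarrow> j"
  have eq: "Q ((v(N := a)) (?\<sigma> 0)) (\<lambda>i. (v(N := a)) (?\<sigma> (Suc i))) \<longleftrightarrow> Q a v" for v a
    using N[of "\<lambda>i. (v(N := a)) (?\<sigma> i)" "case_nat a v"] by (auto split: nat.splits)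
  have "arithP (\<lambda>v. \<exists>a. Q ((v(N := a)) (?\<sigma> 0)) (\<lambda>i. (v(N := a)) (?\<sigma> (Suc i))))"
    by (rule arithP_ex_upd[OF arithP_rename[OF assms]])
  then show ?thesis by (simp only: eq)
qed

lemma arithP_all:
  assumes "arithP (\<lambda>v. Q (v 0) (\<lambda>i. v (Suc i)))"
  shows "arithP (\<lambda>v. \<forall>a. Q a v)"
proof -
  have "arithP (\<lambda>v. \<not> (\<exists>a. \<not> Q a v))" 
    by (rule arithP_not, rule arithP_ex, rule arithP_not, rule assms)
  then show ?thesis by (simp only: not_ex not_not)
qed

lemma arithF_rename:
  assumes "arithF F"
  shows "arithF (\<lambda>v. F (\<lambda>i. v (\<sigma> i)))"
  using arithP_rename[OF assms[unfolded arithF_def], of "case_nat 0 (\<lambda>i. Suc (\<sigma> i))"]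
  by (simp add: arithF_def)

text \<open>There are no terms for the functions, so each variable below the support bound N is
  quantified and fixed by the graph of the function that replaces it.\<close>

lemma arithP_comp:
  assumes P: "arithP P" and F: "\<And>i. arithF (F i)"
  shows "arithP (\<lambda>v. P (\<lambda>i. F i v))"
proof -
  obtain N where N: "\<And>v w. (\<And>i. i < N \<Longrightarrow> v i = w i) \<Longrightarrow> P v \<longleftrightarrow> P w"
    using arithP_support[OF P] by blast
  \<comment> \<open>Variables are replaced one at a time. The arguments of the functions are kept in
    the variables from N on, where overwriting variable n < N does not disturb them.\<close>
  have "arithP (\<lambda>v. P (\<lambda>i. if i < n then F i (\<lambda>j. v (N + j)) else v i))" if "n \<le> N" for n
    using that
  proof (induction n)
    case 0
    then show ?case using P by simp
  next
    case (Suc n)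
    let ?Q = "\<lambda>v. v n = F n (\<lambda>j. v (N + j)) \<and> P (\<lambda>i. if i < n then F i (\<lambda>j. v (N + j)) else v i)"
    have "arithP (\<lambda>v. v n = F n (\<lambda>j. v (N + j)))"
      using arithP_rename[OF F[of n, unfolded arithF_def], of "case_nat n (\<lambda>j. N + j)"] by simp
    then have "arithP ?Q"
      using Suc by (intro arithP_conj) auto
    then have "arithP (\<lambda>v. \<exists>a. ?Q (v(n := a)))" by (rule arithP_ex_upd)
    moreover have "(\<exists>a. ?Q (v(n := a))) \<longleftrightarrow>
        P (\<lambda>i. if i < Suc n then F i (\<lambda>j. v (N + j)) else v i)" for v
    proof -
      have eq: "(\<lambda>j. (v(n := a)) (N + j)) = (\<lambda>j. v (N + j))" for a
        using Suc.prems by auto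
      have "(\<lambda>i. if i < n then F i (\<lambda>j. v (N + j)) else (v(n := F n (\<lambda>j. v (N + j)))) i)
          = (\<lambda>i. if i < Suc n then F i (\<lambda>j. v (N + j)) else v i)"
        by (auto simp: less_Suc_eq)
      moreover have "(\<exists>a. ?Q (v(n := a))) \<longleftrightarrow> 
          P (\<lambda>i. if i < n then F i (\<lambda>j. v (N + j)) else (v(n := F n (\<lambda>j. v (N + j)))) i)"
        by (simp only: eq fun_upd_same simp_thms)
      ultimately show ?thesis by simp
    qed
    ultimately show ?case by simp
  qed
  \<comment> \<open>Shifts the arguments back: variable N + j now reads v j.\<close>
  from arithP_rename[OF this[OF order_refl], of "\<lambda>i. i - N"]
  have "arithP (\<lambda>v. P (\<lambda>i. if i < N then F i v else v (i - N)))"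
    unfolding add_diff_cancel_left' .
  moreover have "P (\<lambda>i. if i < N then F i v else v (i - N)) \<longleftrightarrow> P (\<lambda>i. F i v)" for v
    by (rule N) auto
  ultimately show ?thesis by simp
qed

section \<open>Polynomials, order and division\<close>

lemma arithF_var: "arithF (\<lambda>v. v i)"
  unfolding arithF_def arithP_def by (rule exI[of _ "Eq (Var 0) (Var (Suc i))"]) auto

lemma arithF_const: "arithF (\<lambda>v. c)"
proof -
  define t where "t = ((\<lambda>t. Plus t One) ^^ c) Zero"
  have "teval natS v t = c" for v
    unfolding t_def by (induction c) auto
  then show ?thesis
    unfolding arithF_def arithP_def by (intro exI[of _ "Eq (Var 0) t"]) auto
qed

lemma arithF_comp:
  assumes H: "arithF H" and F: "\<And>i. arithF (F i)"
  shows "arithF (\<lambda>v. H (\<lambda>i. F i v))"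
proof -
  have "arithP (\<lambda>v. (\<lambda>i. case i of 0 \<Rightarrow> v 0 | Suc i \<Rightarrow> F i (\<lambda>j. v (Suc j))) 0
     = H (\<lambda>i. (\<lambda>i. case i of 0 \<Rightarrow> v 0 | Suc i \<Rightarrow> F i (\<lambda>j. v (Suc j))) (Suc i)))"
  proof (rule arithP_comp[OF H[unfolded arithF_def], 
        of "\<lambda>i v. case i of 0 \<Rightarrow> v 0 | Suc i \<Rightarrow> F i (\<lambda>j. v (Suc j))"])
    show "arithF (\<lambda>v. case i of 0 \<Rightarrow> v 0 | Suc i \<Rightarrow> F i (\<lambda>j. v (Suc j)))" for i
      by (cases i) (auto intro: arithF_var arithF_rename[OF F])
  qed
  then show ?thesis unfolding arithF_def by simp
qed

lemma arithP_comp1: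
  assumes "arithP (\<lambda>v. R (v 0))" "arithF F"
  shows "arithP (\<lambda>v. R (F v))"
  by (rule arithP_comp[OF assms(1), of "\<lambda>_. F"]) (rule assms(2))

lemma arithP_comp2:
  assumes "arithP (\<lambda>v. R (v 0) (v 1))" "arithF F" "arithF G"
  shows "arithP (\<lambda>v. R (F v) (G v))"
  using arithP_comp[OF assms(1), of "\<lambda>i. if i = 0 then F else G"] assms(2,3) by simp

lemma arithF_comp1:
  assumes "arithF (\<lambda>v. f (v 0))" "arithF F"
  shows "arithF (\<lambda>v. f (F v))"
  by (rule arithF_comp[OF assms(1), of "\<lambda>_. F"]) (rule assms(2))

lemma arithF_comp2:
  assumes "arithF (\<lambda>v. f (v 0) (v 1))" "arithF F" "arithF G"
  shows "arithF (\<lambda>v. f (F v) (G v))"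
  using arithF_comp[OF assms(1), of "\<lambda>i. if i = 0 then F else G"] assms(2,3) by simp

lemma arithF_plus: "arithF F \<Longrightarrow> arithF G \<Longrightarrow> arithF (\<lambda>v. F v + G v)"
proof (rule arithF_comp2[where f="(+)"])
  show "arithF (\<lambda>v. v 0 + v 1)"
    unfolding arithF_def arithP_def
    by (rule exI[of _ "Eq (Var 0) (Plus (Var 1) (Var 2))"]) (auto simp: numeral_2_eq_2)
qed

lemma arithF_times: "arithF F \<Longrightarrow> arithF G \<Longrightarrow> arithF (\<lambda>v. F v * G v)"
proof (rule arithF_comp2[where f="(*)"])
  show "arithF (\<lambda>v. v 0 * v 1)"
    unfolding arithF_def arithP_def
    by (rule exI[of _ "Eq (Var 0) (Times (Var 1) (Var 2))"]) (auto simp: numeral_2_eq_2)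
qed

lemma arithF_Suc: "arithF F \<Longrightarrow> arithF (\<lambda>v. Suc (F v))"
  using arithF_plus[OF _ arithF_const[of 1]] by simp

lemma arithP_eq: "arithF F \<Longrightarrow> arithF G \<Longrightarrow> arithP (\<lambda>v. F v = G v)"
proof (rule arithP_comp2[where R="(=)"])
  show "arithP (\<lambda>v. v 0 = v 1)"
    unfolding arithP_def by (rule exI[of _ "Eq (Var 0) (Var 1)"]) auto
qed

lemma arithP_le: "arithF F \<Longrightarrow> arithF G \<Longrightarrow> arithP (\<lambda>v. F v \<le> G v)"
proof (rule arithP_comp2[where R="(\<le>)"])
  show "arithP (\<lambda>v. v 0 \<le> v 1)"
    unfolding arithP_def by (rule exI[of _ "Leq (Var 0) (Var 1)"]) auto
qed

lemma arithP_less: "arithF F \<Longrightarrow> arithF G \<Longrightarrow> arithP (\<lambda>v. F v < G v)"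
  using arithP_le[OF arithF_Suc, of F G] by (simp add: Suc_le_eq)

lemmas arith_intros = arithP_eq arithP_le arithP_less arithP_not arithP_conj arithP_disj arithP_imp
  arithP_ex arithP_all arithF_var arithF_const arithF_plus arithF_times arithF_Suc

lemma arithF_graph: 
  assumes "arithP (\<lambda>v. R (v 0) (\<lambda>i. v (Suc i)))" "\<And>z v. z = F v \<longleftrightarrow> R z v"
  shows "arithF F"
  using assms by (simp add: arithF_def)

lemma arithP_dvd: "arithF F \<Longrightarrow> arithF G \<Longrightarrow> arithP (\<lambda>v. F v dvd G v)"
  by (rule arithP_comp2[where R="(dvd)"]) (unfold dvd_def, intro arith_intros)

lemma arithF_div: "arithF F \<Longrightarrow> arithF G \<Longrightarrow> arithF (\<lambda>v. F v div G v)"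
proof (rule arithF_comp2[where f="(div)"])
  have *: "z = x div y \<longleftrightarrow> (y = 0 \<and> z = 0) \<or> (\<exists>r. r < y \<and> x = z * y + r)" for x y z :: nat
  proof (cases "y = 0")
    case False
    then have "z = x div y \<longleftrightarrow> (\<exists>r. r < y \<and> x = z * y + r)"
      by (metis add.commute div_mult_mod_eq div_mult_self3 div_less add_0 mod_less_divisor bot_nat_0.not_eq_extremum)
    with False show ?thesis by simp
  qed simp
  show "arithF (\<lambda>v. v 0 div v 1)"
    by (rule arithF_graph[OF _ *]) (intro arith_intros)
qed

lemma arithF_mod: "arithF F \<Longrightarrow> arithF G \<Longrightarrow> arithF (\<lambda>v. F v mod G v)"
proof (rule arithF_comp2[where f="(mod)"])
  have *: "z = x mod y \<longleftrightarrow> x = x div y * y + z" for x y z :: nat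
    by (metis add_left_cancel div_mult_mod_eq)
  show "arithF (\<lambda>v. v 0 mod v 1)"
    by (rule arithF_graph[OF _ *]) (intro arith_intros arithF_div)
qed

lemma arithF_if: "arithP P \<Longrightarrow> arithF F \<Longrightarrow> arithF G \<Longrightarrow> arithF (\<lambda>v. if P v then F v else G v)"
proof -
  assume a: "arithP P" "arithF F" "arithF G"
  have *: "z = (if P v then F v else G v) \<longleftrightarrow> (P v \<and> z = F v) \<or> (\<not> P v \<and> z = G v)" for z v
    by auto
  show ?thesis
    by (rule arithF_graph[OF _ *]) (intro arith_intros arithP_rename[OF a(1)] arithF_rename[OF a(2)] arithF_rename[OF a(3)])
qed

section \<open>Goedel's beta function and definitions by recursion\<close>

definition beta :: "nat \<Rightarrow> nat \<Rightarrow> nat \<Rightarrow> nat" where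
  "beta c d i = c mod Suc (Suc i * d)"

lemma arithF_beta: "arithF F \<Longrightarrow> arithF G \<Longrightarrow> arithF H \<Longrightarrow> arithF (\<lambda>v. beta (F v) (G v) (H v))"
  unfolding beta_def by (intro arith_intros arithF_mod)

text \<open>A prime dividing both moduli divides (j - i) * M!. As j - i \<le> M, it divides M! in
  either case, and hence 1.\<close>

lemma beta_moduli_coprime:
  fixes i j M :: nat
  assumes "i < j" "j \<le> M"
  shows "coprime (Suc (Suc i * fact M)) (Suc (Suc j * fact M))"
proof (rule ccontr)
  assume "\<not> ?thesis"
  then obtain p where p: "prime p" "p dvd Suc (Suc i * fact M)" "p dvd Suc (Suc j * fact M)"
    by (meson coprime_iff_gcd_eq_1 prime_factor_nat dvd_trans gcd_dvd1 gcd_dvd2)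
  have "p dvd Suc (Suc j * fact M) - Suc (Suc i * fact M)" using p by (intro dvd_diff_nat)
  also have "Suc (Suc j * fact M) - Suc (Suc i * fact M) = (j - i) * fact M"
    using assms by (simp add: algebra_simps diff_mult_distrib)
  finally have "p dvd j - i \<or> p dvd fact M" using p(1) by (simp add: prime_dvd_mult_iff)
  moreover have "j - i dvd fact M" using assms by (intro dvd_fact) auto
  ultimately have "p dvd Suc i * fact M" by (meson dvd_trans dvd_mult)
  then have "p dvd 1" using p(2) by (metis Suc_eq_plus1 dvd_add_right_iff)
  then show False using p(1) by simp
qed

lemma beta_exists: "\<exists>c d. \<forall>i\<le>n. beta c d i = f i"
proof -
  \<comment> \<open>The summand n makes the moduli coprime; the sum of the values makes each modulus
    exceed the residue it has to encode.\<close>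
  define M where "M = n + (\<Sum>i\<le>n. f i)"
  let ?m = "\<lambda>i. Suc (Suc i * fact M)"
  have "\<forall>i\<in>{..n}. \<forall>j\<in>{..n}. i \<noteq> j \<longrightarrow> coprime (?m i) (?m j)"
  proof (intro ballI impI)
    fix i j assume "i \<in> {..n}" "j \<in> {..n}" "i \<noteq> j"
    then show "coprime (?m i) (?m j)"
      using beta_moduli_coprime[of i j M] beta_moduli_coprime[of j i M]
      by (cases "i < j") (auto simp: M_def coprime_commute simp del: mult_Suc)
  qed
  from chinese_remainder_nat[OF finite_atMost this, of f]
  obtain c where c: "\<forall>i\<in>{..n}. [c = f i] (mod ?m i)" by blast
  have "beta c (fact M) i = f i" if "i \<le> n" for i
  proof -
    have "f i \<le> M"
      unfolding M_def using that member_le_sum[of i "{..n}" f] by (simp add: trans_le_add2)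
    also have "M \<le> fact M" by (rule fact_ge_self)
    also have "fact M < ?m i" by simp
    finally have "f i < ?m i" .
    then show ?thesis using c that unfolding beta_def cong_def by (auto simp del: mult_Suc)
  qed
  then show ?thesis by blast
qed

text \<open>Two numbers code the sequence of intermediate values through \<open>beta\<close>, which
  turns the recursion into a bounded check of its steps.\<close>

lemma arithF_rec:
  assumes g: "arithF g" and h: "arithF (\<lambda>v. h (v 0) (v 1) (\<lambda>i. v (Suc (Suc i))))" and N: "arithF N"
  shows "arithF (\<lambda>v. rec_nat (g v) (\<lambda>n r. h n r v) (N v))"
proof -
  have *: "z = rec_nat (g v) (\<lambda>n r. h n r v) (N v) \<longleftrightarrow>
      (\<exists>c d. beta c d 0 = g v \<and> (\<forall>i. i < N v \<longrightarrow> beta c d (Suc i) = h i (beta c d i) v) \<and> z = beta c d (N v))"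
    (is "_ \<longleftrightarrow> ?R z v") for z v
  proof
    assume z: "z = rec_nat (g v) (\<lambda>n r. h n r v) (N v)"
    obtain c d where "\<forall>i\<le>N v. beta c d i = rec_nat (g v) (\<lambda>n r. h n r v) i"
      using beta_exists[of "N v" "rec_nat (g v) (\<lambda>n r. h n r v)"] by blast
    then have "beta c d 0 = g v \<and> (\<forall>i. i < N v \<longrightarrow> beta c d (Suc i) = h i (beta c d i) v) \<and> z = beta c d (N v)"
      using z by auto
    then show "?R z v" by blast
  next
    assume "?R z v"
    then obtain c d where cd: "beta c d 0 = g v" "\<And>i. i < N v \<Longrightarrow> beta c d (Suc i) = h i (beta c d i) v" 
      "z = beta c d (N v)" by blast
    have "beta c d i = rec_nat (g v) (\<lambda>n r. h n r v) i" if "i \<le> N v" for i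
      using that by (induction i) (auto simp: cd)
    then show "z = rec_nat (g v) (\<lambda>n r. h n r v) (N v)" using cd by simp
  qed
  have h': "arithF (\<lambda>v. h (F v) (G v) (\<lambda>i. v (\<sigma> i)))" if "arithF F" "arithF G" for F G \<sigma>
  proof -
    have "arithF (\<lambda>v. (\<lambda>u. h (u 0) (u 1) (\<lambda>i. u (Suc (Suc i)))) 
        (\<lambda>i. (\<lambda>i. if i = 0 then F else if i = 1 then G else (\<lambda>v. v (\<sigma> (i - 2)))) i v))"
      using that by (intro arithF_comp[OF h]) (auto intro: arithF_var)
    then show ?thesis by simp
  qed
  show ?thesis
    by (rule arithF_graph[OF _ *])
      (intro arith_intros h' arithF_beta arithF_rename[OF g] arithF_rename[OF N])
qed

lemma arithF_power: "arithF F \<Longrightarrow> arithF G \<Longrightarrow> arithF (\<lambda>v. F v ^ G v)"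
proof (rule arithF_comp2[where f="(^)"])
  have "x ^ n = rec_nat 1 (\<lambda>_ r. r * x) n" for x n :: nat by (induction n) auto
  then show "arithF (\<lambda>v. v 0 ^ v 1)"
    by (simp only:) (intro arithF_rec arith_intros)
qed

lemma arithF_sum:
  assumes "arithF (\<lambda>v. g (v 0) (\<lambda>i. v (Suc i)))" "arithF N"
  shows "arithF (\<lambda>v. \<Sum>i<N v. g i v)"
proof -
  have "sum f {..<n} = rec_nat 0 (\<lambda>i r. r + f i) n" for f :: "nat \<Rightarrow> nat" and n by (induction n) auto
  then have "(\<lambda>v. \<Sum>i<N v. g i v) = (\<lambda>v. rec_nat 0 (\<lambda>i r. r + g i v) (N v))" by auto
  moreover have "arithF (\<lambda>v. rec_nat 0 (\<lambda>i r. r + g i v) (N v))"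
    using arithF_rename[OF assms(1), of "case_nat 0 (\<lambda>i. Suc (Suc i))"] assms(2)
    by (intro arithF_rec arith_intros) auto
  ultimately show ?thesis by simp
qed

lemma arithF_prod:
  assumes "arithF (\<lambda>v. g (v 0) (\<lambda>i. v (Suc i)))" "arithF N"
  shows "arithF (\<lambda>v. \<Prod>i<N v. g i v)"
proof -
  have "prod f {..<n} = rec_nat 1 (\<lambda>i r. r * f i) n" for f :: "nat \<Rightarrow> nat" and n by (induction n) auto
  then have "(\<lambda>v. \<Prod>i<N v. g i v) = (\<lambda>v. rec_nat 1 (\<lambda>i r. r * g i v) (N v))" by auto
  moreover have "arithF (\<lambda>v. rec_nat 1 (\<lambda>i r. r * g i v) (N v))"
    using arithF_rename[OF assms(1), of "case_nat 0 (\<lambda>i. Suc (Suc i))"] assms(2)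
    by (intro arithF_rec arith_intros) auto
  ultimately show ?thesis by simp
qed

section \<open>Codes of pairs and lists\<close>

lemma arithF_prod_encode: "arithF F \<Longrightarrow> arithF G \<Longrightarrow> arithF (\<lambda>v. prod_encode (F v, G v))"
  unfolding prod_encode_def triangle_def prod.case by (intro arith_intros arithF_div)

text \<open>\<open>list_encode\<close> sends the empty list to 0 and any other list to the successor
  of the code of the pair of its head and the code of its tail.\<close>

definition code_hd :: "nat \<Rightarrow> nat" where
  "code_hd s = (if s = 0 then 0 else fst (prod_decode (s - 1)))"

definition code_tl :: "nat \<Rightarrow> nat" where
  "code_tl s = (if s = 0 then 0 else snd (prod_decode (s - 1)))"

definition code_drop :: "nat \<Rightarrow> nat \<Rightarrow> nat" where
  "code_drop i s = rec_nat s (\<lambda>_. code_tl) i"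

lemma prod_decode_eq_iff: "prod_decode n = (x, y) \<longleftrightarrow> n = prod_encode (x, y)"
  by (metis prod_decode_inverse prod_encode_inverse)

lemma code_hd_iff: "z = code_hd s \<longleftrightarrow> (s = 0 \<and> z = 0) \<or> (\<exists>t. s = Suc (prod_encode (z, t)))"
proof (cases s)
  case (Suc n)
  then show ?thesis
    by (cases "prod_decode n") (auto simp: code_hd_def prod_decode_eq_iff)
qed (auto simp: code_hd_def)

lemma code_tl_iff: "z = code_tl s \<longleftrightarrow> (s = 0 \<and> z = 0) \<or> (\<exists>x. s = Suc (prod_encode (x, z)))"
proof (cases s)
  case (Suc n)
  then show ?thesis
    by (cases "prod_decode n") (auto simp: code_tl_def prod_decode_eq_iff)
qed (auto simp: code_tl_def)

lemma arithF_code_hd: "arithF F \<Longrightarrow> arithF (\<lambda>v. code_hd (F v))"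
  by (rule arithF_comp1, rule arithF_graph[OF _ code_hd_iff]) (intro arith_intros arithF_prod_encode)

lemma arithF_code_tl: "arithF F \<Longrightarrow> arithF (\<lambda>v. code_tl (F v))"
  by (rule arithF_comp1, rule arithF_graph[OF _ code_tl_iff]) (intro arith_intros arithF_prod_encode)

lemma arithF_code_drop: "arithF F \<Longrightarrow> arithF G \<Longrightarrow> arithF (\<lambda>v. code_drop (F v) (G v))"
proof (rule arithF_comp2[where f = code_drop])
  show "arithF (\<lambda>v. code_drop (v 0) (v 1))"
    unfolding code_drop_def by (intro arithF_rec arith_intros arithF_code_tl)
qed

lemma list_decode_code_tl: "list_decode (code_tl s) = tl (list_decode s)"
  by (cases s) (auto simp: code_tl_def split: prod.splits)

lemma list_decode_code_drop: "list_decode (code_drop i s) = drop i (list_decode s)"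
  by (induction i) (auto simp: code_drop_def list_decode_code_tl tl_drop drop_Suc)

lemma list_decode_eq_Nil: "list_decode s = [] \<longleftrightarrow> s = 0"
  by (metis list_decode.simps(1) list_decode_eq)

lemma code_drop_eq_0: "code_drop i s = 0 \<longleftrightarrow> length (list_decode s) \<le> i"
  using list_decode_eq_Nil[of "code_drop i s"] by (simp add: list_decode_code_drop)

lemma code_hd_list_decode: "s \<noteq> 0 \<Longrightarrow> code_hd s = hd (list_decode s)"
  by (cases s) (auto simp: code_hd_def split: prod.splits)

lemma code_hd_code_drop:
  assumes "i < length (list_decode s)" 
  shows "code_hd (code_drop i s) = list_decode s ! i"
proof -
  have "code_drop i s \<noteq> 0" using assms by (simp add: code_drop_eq_0)
  then show ?thesis using assms by (simp add: code_hd_list_decode list_decode_code_drop hd_drop_conv_nth)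
qed

lemma length_list_decode_iff: 
  "l = length (list_decode s) \<longleftrightarrow> code_drop l s = 0 \<and> (\<forall>i<l. code_drop i s \<noteq> 0)"
  by (auto simp: code_drop_eq_0 not_le intro: le_antisym leI)

lemma arithF_length: "arithF F \<Longrightarrow> arithF (\<lambda>v. length (list_decode (F v)))"
  by (rule arithF_comp1[where f = "\<lambda>s. length (list_decode s)"], rule arithF_graph[OF _ length_list_decode_iff])
    (intro arith_intros arithF_code_drop)

lemma prod_list_list_decode:
  "prod_list (list_decode s) = (\<Prod>i<length (list_decode s). code_hd (code_drop i s))"
  by (simp add: code_hd_code_drop prod.list_conv_set_nth atLeast0LessThan)

text \<open>Variables from k on cannot influence membership in R; sending them to 0, which is below
  k, confines the free variables as \<open>defines_in_N\<close> demands.\<close>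

lemma arith_defines:
  assumes "arithP (\<lambda>v. map v [0..<k] \<in> R)" "k > 0"
  shows "\<exists>\<phi>. defines_in_N k R \<phi>"
proof -
  obtain \<phi> where \<phi>: "pure \<phi>" "\<And>v. sat natS {} v \<phi> \<longleftrightarrow> map v [0..<k] \<in> R"
    using assms(1) unfolding arithP_def by blast
  define \<sigma> where "\<sigma> = (\<lambda>i. if i < k then i else 0)"
  have "fvars (rename_fm \<sigma> \<phi>) \<subseteq> {..<k}"
    using fvars_rename[of \<sigma> \<phi>] assms(2) by (auto simp: \<sigma>_def subset_iff split: if_splits)
  moreover have "sat natS {} (asg xs (\<lambda>_. 0)) (rename_fm \<sigma> \<phi>) \<longleftrightarrow> xs \<in> R" if "length xs = k" for xs
  proof -
    have "map (asg xs (\<lambda>_. 0) \<circ> \<sigma>) [0..<k] = xs"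
      using that by (intro nth_equalityI) (auto simp: asg_def \<sigma>_def)
    then show ?thesis by (simp only: sat_rename \<phi>)
  qed
  ultimately have "defines_in_N k R (rename_fm \<sigma> \<phi>)"
    unfolding defines_in_N_def using \<phi>(1) by (auto simp: pure_rename)
  then show ?thesis by blast
qed

section \<open>Arithmetical definitions of the coding relations\<close>

lemma upt_numerals: "[0..<3] = [0, 1, 2]" "[0..<2] = [0, 1]"
  by (simp_all add: upt_rec)

lemma arithP_memN: "arithP (\<lambda>v. map v [0..<2] \<in> memN)"
proof -
  have "(\<lambda>v. map v [0..<2] \<in> memN) = (\<lambda>v. \<not> 2 dvd v 1 div 2 ^ v 0)"
    by (auto simp: memN_def upt_numerals)
  then show ?thesis
    by (simp only:) (intro arith_intros arithP_dvd arithF_div arithF_power)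
qed

lemma tupN_2: "[x, y, c] \<in> tupN 2 \<longleftrightarrow> c = list_encode [x, y]"
  by (auto simp: tupN_def length_Suc_conv numeral_2_eq_2)

lemma arithP_tupN: "arithP (\<lambda>v. map v [0..<3] \<in> tupN 2)"
proof -
  have "(\<lambda>v. map v [0..<3] \<in> tupN 2) = (\<lambda>v. v 2 = Suc (prod_encode (v 0, Suc (prod_encode (v 1, 0)))))"
    by (simp add: tupN_2 upt_numerals)
  then show ?thesis
    by (simp only:) (intro arith_intros arithF_prod_encode)
qed

lemma arithP_lenN: "arithP (\<lambda>v. map v [0..<2] \<in> lenN)"
proof -
  have "(\<lambda>v. map v [0..<2] \<in> lenN) = (\<lambda>v. length (list_decode (v 0)) = v 1)"
    by (auto simp: lenN_def upt_numerals)
  then show ?thesis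
    by (simp only:) (intro arith_intros arithF_length)
qed

lemma arithP_nthN: "arithP (\<lambda>v. map v [0..<3] \<in> nthN)"
proof -
  have "(\<lambda>v. map v [0..<3] \<in> nthN) = 
     (\<lambda>v. v 1 < length (list_decode (v 0)) \<and> code_hd (code_drop (v 1) (v 0)) = v 2)"
    by (auto simp: nthN_def upt_numerals code_hd_code_drop)
  then show ?thesis
    by (simp only:) (intro arith_intros arithF_length arithF_code_hd arithF_code_drop)
qed

lemma arithP_prodN: "arithP (\<lambda>v. map v [0..<2] \<in> prodN)"
proof -
  have "(\<lambda>v. map v [0..<2] \<in> prodN) = 
     (\<lambda>v. v 1 = (\<Prod>i<length (list_decode (v 0)). code_hd (code_drop i (v 0))))"
    by (auto simp: prodN_def upt_numerals prod_list_list_decode)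
  then show ?thesis
    by (simp only:) (intro arith_intros arithF_prod arithF_length arithF_code_hd arithF_code_drop)
qed

section \<open>Additive weights and modified powers\<close>

text \<open>Three numbers determine the weights, so in the ultrapower they are given by three
  parameters of a formula.\<close>

definition wt :: "nat \<times> nat \<times> nat \<Rightarrow> nat \<Rightarrow> nat" where
  "wt w p = (case w of (\<alpha>, \<beta>, \<gamma>) \<Rightarrow> if p = 2 then \<alpha> else if p = 3 then \<beta> else if p = 5 then \<gamma> else 1)"

definition phi :: "nat \<Rightarrow> (nat \<Rightarrow> nat) \<Rightarrow> nat \<Rightarrow> nat" where
  "phi G w x = (\<Sum>p\<in>prime_factors G. w p * multiplicity p x)"

definition part :: "nat \<Rightarrow> nat \<Rightarrow> nat" where
  "part G x = (\<Prod>p\<in>prime_factors G. p ^ multiplicity p x)"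

text \<open>The exponent y with ideal part s acts on exponent vectors as (y - s) + sP. For positive
  x and admissible y, s as defined below, both divisions are exact.\<close>

definition pw :: "nat \<Rightarrow> (nat \<Rightarrow> nat) \<Rightarrow> nat \<Rightarrow> nat \<Rightarrow> nat \<Rightarrow> nat" where
  "pw G w s x y = x ^ y * G ^ (phi G w x * (s div phi G w G)) div part G x ^ s"

section \<open>Arithmetical definability of the modified powers\<close>

lemma arithP_prime: "arithF F \<Longrightarrow> arithP (\<lambda>v. prime (F v))"
  by (rule arithP_comp1[where R = prime]) (unfold prime_nat_iff, intro arith_intros arithP_dvd)

lemma prime_multiplicity_iff:
  fixes p x z :: nat
  shows "z = (if prime p then multiplicity p x else 0) \<longleftrightarrow>
   (if prime p \<and> x \<noteq> 0 then p ^ z dvd x \<and> \<not> p ^ Suc z dvd x else z = 0)"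
proof (cases "prime p \<and> x \<noteq> 0")
  case True
  then have "\<not> is_unit p" by auto
  with True have *: "p ^ n dvd x \<longleftrightarrow> n \<le> multiplicity p x" for n
    by (intro power_dvd_iff_le_multiplicity) auto
  have "z = multiplicity p x \<longleftrightarrow> z \<le> multiplicity p x \<and> \<not> Suc z \<le> multiplicity p x" by linarith
  with True show ?thesis by (simp only: * if_True simp_thms)
qed auto

lemma arithF_multiplicity: 
  "arithF F \<Longrightarrow> arithF G \<Longrightarrow> arithF (\<lambda>v. if prime (F v) then multiplicity (F v) (G v) else 0)"
proof (rule arithF_comp2[where f = "\<lambda>p x. if prime p then multiplicity p x else 0"])
  have *: "z = (if prime p then multiplicity p x else 0) \<longleftrightarrow>
   ((prime p \<and> x \<noteq> 0 \<longrightarrow> p ^ z dvd x \<and> \<not> p ^ Suc z dvd x) \<and> (\<not> (prime p \<and> x \<noteq> 0) \<longrightarrow> z = 0))" for z p x :: nat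
    unfolding prime_multiplicity_iff by (simp split: if_splits)
  show "arithF (\<lambda>v. if prime (v 0) then multiplicity (v 0) (v 1) else 0)"
    by (rule arithF_graph[OF _ *]) (intro arith_intros arithP_prime arithP_dvd arithF_power)
qed

lemma prime_factors_lessThan:
  "G > 0 \<Longrightarrow> prime_factors G = {p \<in> {..<Suc G}. prime p \<and> p dvd G}" for G :: nat
  by (auto simp: prime_factors_dvd less_Suc_eq_le dvd_imp_le)

lemma phi_eq: "phi G w x = (if G = 0 then 0 else \<Sum>p<Suc G. 
    if prime p \<and> p dvd G then w p * (if prime p then multiplicity p x else 0) else 0)"
proof (cases "G = 0")
  case False
  then show ?thesis unfolding phi_def prime_factors_lessThan[OF False[unfolded neq0_conv]]
    by (subst sum.inter_filter) (auto intro!: sum.cong simp del: sum.lessThan_Suc)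
qed (simp add: phi_def)

lemma part_eq: "part G x = (if G = 0 then 1 else \<Prod>p<Suc G. 
    if prime p \<and> p dvd G then p ^ (if prime p then multiplicity p x else 0) else 1)"
proof (cases "G = 0")
  case False
  then show ?thesis unfolding part_def prime_factors_lessThan[OF False[unfolded neq0_conv]]
    by (subst prod.inter_filter) (auto intro!: prod.cong simp del: prod.lessThan_Suc)
qed (simp add: part_def)

lemma arithF_phi:
  assumes "arithF G" "arithF A" "arithF B" "arithF C" "arithF X"
  shows "arithF (\<lambda>v. phi (G v) (wt (A v, B v, C v)) (X v))"
  unfolding phi_eq wt_def prod.case
  by (intro arithF_if arithF_sum arith_intros arithP_prime arithP_dvd arithF_multiplicity
    assms arithF_rename[OF assms(1)] arithF_rename[OF assms(2)] arithF_rename[OF assms(3)] 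
    arithF_rename[OF assms(4)] arithF_rename[OF assms(5)])

lemma arithF_part:
  assumes "arithF G" "arithF X"
  shows "arithF (\<lambda>v. part (G v) (X v))"
  unfolding part_eq
  by (intro arithF_if arithF_prod arith_intros arithP_prime arithP_dvd arithF_multiplicity arithF_power
    assms arithF_rename[OF assms(1)] arithF_rename[OF assms(2)])

lemma arithF_pw:
  assumes "arithF G" "arithF A" "arithF B" "arithF C" "arithF S" "arithF X" "arithF Y"
  shows "arithF (\<lambda>v. pw (G v) (wt (A v, B v, C v)) (S v) (X v) (Y v))"
  unfolding pw_def
  by (intro arithF_div arithF_times arithF_power arithF_phi arithF_part assms)

section \<open>Algebra of the modified powers\<close>

lemma phi_mult: "x > 0 \<Longrightarrow> z > 0 \<Longrightarrow> phi G w (x * z) = phi G w x + phi G w z"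
  unfolding phi_def sum.distrib[symmetric]
  by (intro sum.cong) (auto simp: prime_elem_multiplicity_mult_distrib algebra_simps dest: in_prime_factors_imp_prime)

text \<open>As D is the weighted number of prime factors of G, the matrix P fixes the exponent
  vector of G and is therefore idempotent.\<close>

locale weights =
  fixes G :: nat and w :: "nat \<Rightarrow> nat" and D :: nat
  assumes G_gt_1: "G > 1" and w_pos: "p \<in> prime_factors G \<Longrightarrow> w p \<ge> 1"
    and D_eq: "D = phi G w G" and D_gt_1: "D > 1"
begin

text \<open>The divisibility makes s / D an integer. The inequality lets x^y and G^(phi(x) s / D)
  together absorb the divisor \<open>part G x ^ s\<close>, see
  \<open>part_power_dvd\<close>.\<close>

definition adm :: "nat \<Rightarrow> nat \<Rightarrow> bool" where
  "adm y s \<longleftrightarrow> D dvd s \<and> s \<le> y + s div D"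

text \<open>The logarithm of the value at x of the idempotent matrix: on logarithms the exponent
  y = s + k acts as k ln + s lam, see ln_pw and lam_pw.\<close>
definition lam :: "nat \<Rightarrow> real" where
  "lam x = ln (real x) - ln (real (part G x)) + real (phi G w x) * ln (real G) / real D"

lemma part_mult: "x > 0 \<Longrightarrow> z > 0 \<Longrightarrow> part G (x * z) = part G x * part G z"
  unfolding part_def prod.distrib[symmetric]
  by (intro prod.cong) (auto simp: prime_elem_multiplicity_mult_distrib power_add dest: in_prime_factors_imp_prime)

lemma phi_0 [simp]: "phi G w 0 = 0" and phi_1 [simp]: "phi G w (Suc 0) = 0"
  and part_0 [simp]: "part G 0 = 1" and part_1 [simp]: "part G (Suc 0) = 1"
  by (auto simp: phi_def part_def)

lemma part_pos [simp]: "part G x > 0"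
  unfolding part_def by (auto intro!: prod_pos simp: prime_gt_0_nat in_prime_factors_iff)

lemma multiplicity_part:
  "prime p \<Longrightarrow> multiplicity p (part G x) = (if p \<in> prime_factors G then multiplicity p x else 0)"
  unfolding part_def by (intro multiplicity_prod_prime_powers) auto

lemma multiplicity_part': "p \<in> prime_factors G \<Longrightarrow> multiplicity p (part G x) = multiplicity p x"
  by (subst multiplicity_part) (auto intro: in_prime_factors_imp_prime)

lemma part_dvd: "x > 0 \<Longrightarrow> part G x dvd x"
  by (rule multiplicity_le_imp_dvd) (use part_pos[of x] in \<open>auto simp: multiplicity_part\<close>)

lemma part_part [simp]: "part G (part G x) = part G x"
  unfolding part_def[of G "part G x"] unfolding part_def[of G x, symmetric]
  by (subst (2) part_def) (auto intro!: prod.cong simp: multiplicity_part')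

lemma phi_part [simp]: "phi G w (part G x) = phi G w x"
  unfolding phi_def by (auto intro!: sum.cong simp: multiplicity_part')

lemma part_of_dvd: "x dvd G \<Longrightarrow> part G x = x"
proof -
  assume x: "x dvd G"
  then have "x > 0" using G_gt_1 by (auto intro: Nat.gr0I)
  moreover have "multiplicity p (part G x) = multiplicity p x" if "prime p" for p
    using that x G_gt_1 by (auto simp: multiplicity_part in_prime_factors_iff intro: not_dvd_imp_multiplicity_0 dest: dvd_trans)
  ultimately show ?thesis using part_pos[of x]
    by (intro dvd_antisym multiplicity_le_imp_dvd) auto
qed

text \<open>Holds factor by factor: p divides G and has weight at least 1.\<close>

lemma part_dvd_power: "part G x dvd G ^ phi G w x"
  unfolding part_def phi_def power_sum
proof (rule prod_dvd_prod)
  fix p assume p: "p \<in> prime_factors G"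
  then have "p ^ multiplicity p x dvd G ^ multiplicity p x" by (intro dvd_power_same) auto
  also have "\<dots> dvd G ^ (w p * multiplicity p x)" using w_pos[OF p] by (intro le_imp_power_dvd) auto
  finally show "p ^ multiplicity p x dvd G ^ (w p * multiplicity p x)" .
qed

text \<open>Of the s copies of the part of x, y can be taken from x^y and j from the powers of
  G.\<close>

lemma part_power_dvd:
  assumes "x > 0" "s \<le> y + j"
  shows "part G x ^ s dvd x ^ y * G ^ (phi G w x * j)"
proof -
  have "part G x ^ s dvd part G x ^ (y + j)" using assms by (intro le_imp_power_dvd)
  also have "part G x ^ (y + j) dvd x ^ y * (G ^ phi G w x) ^ j"
    unfolding power_add using assms by (intro mult_dvd_mono dvd_power_same part_dvd part_dvd_power)
  finally show ?thesis by (simp add: power_mult)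
qed

lemma pw_mult_part:
  assumes "x > 0" "adm y s"
  shows "pw G w s x y * part G x ^ s = x ^ y * G ^ (phi G w x * (s div D))"
proof -
  have "part G x ^ s dvd x ^ y * G ^ (phi G w x * (s div D))"
    using part_power_dvd[of x s y "s div D"] assms by (simp add: adm_def)
  then show ?thesis by (simp add: pw_def D_eq[symmetric])
qed

lemma pw_pos:
  assumes "x > 0" "adm y s"
  shows "pw G w s x y > 0"
proof -
  have "pw G w s x y * part G x ^ s > 0"
    unfolding pw_mult_part[OF assms] using assms G_gt_1 by simp
  then show ?thesis by simp
qed

text \<open>The standard part y - s multiplies ln x, the ideal part s multiplies
  \<open>lam x\<close>. The laws of the power thus reduce to polynomial identities in the
  exponents.\<close>

lemma ln_pw:
  assumes "x > 0" "adm y s"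
  shows "ln (real (pw G w s x y)) = (real y - real s) * ln x + s * lam x"
proof -
  have "ln (real (pw G w s x y * part G x ^ s)) = ln (real (x ^ y * G ^ (phi G w x * (s div D))))"
    by (simp only: pw_mult_part[OF assms])
  moreover have "real (s div D) = s / D" using assms by (auto simp: adm_def real_of_nat_div)
  ultimately have "ln (real (pw G w s x y)) + s * ln (part G x) = y * ln x + phi G w x * (s / D) * ln G"
    using pw_pos[OF assms] assms G_gt_1 by (simp add: ln_mult ln_realpow)
  then show ?thesis by (simp add: lam_def algebra_simps)
qed

lemma lam_mult: "x > 0 \<Longrightarrow> z > 0 \<Longrightarrow> lam (x * z) = lam x + lam z"
  by (simp add: lam_def phi_mult part_mult ln_mult algebra_simps add_divide_distrib)

lemma lam_1 [simp]: "lam (Suc 0) = 0"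
  by (simp add: lam_def)

lemma lam_power: "x > 0 \<Longrightarrow> lam (x ^ n) = n * lam x"
  by (induction n) (auto simp: lam_mult algebra_simps)

lemma lam_part: "lam (part G x) = phi G w x * ln G / D"
  by (simp add: lam_def)

lemma lam_G: "lam G = ln G"
  using D_gt_1 by (simp add: lam_def part_of_dvd D_eq[symmetric])

text \<open>Idempotency of P in the form (k + sP)P = (k + s)P: on \<open>lam\<close> the modified
  power acts like the ordinary power with exponent y.\<close>

lemma lam_pw:
  assumes "x > 0" "adm y s"
  shows "lam (pw G w s x y) = y * lam x"
proof -
  have "lam (pw G w s x y * part G x ^ s) = lam (x ^ y * G ^ (phi G w x * (s div D)))"
    by (simp only: pw_mult_part[OF assms])
  moreover have "real (s div D) = s / D" using assms by (auto simp: adm_def real_of_nat_div)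
  ultimately have "lam (pw G w s x y) + s * (phi G w x * ln G / D) = y * lam x + phi G w x * (s / D) * ln G"
    using pw_pos[OF assms] assms G_gt_1 by (simp add: lam_mult lam_power lam_part lam_G)
  then show ?thesis by (simp add: algebra_simps)
qed

lemma adm_0: "adm 0 s \<Longrightarrow> s = 0"
proof (rule ccontr)
  assume "adm 0 s" "s \<noteq> 0"
  then have "s \<le> s div D" by (simp add: adm_def)
  moreover have "s div D < s" using \<open>s \<noteq> 0\<close> D_gt_1 by (intro div_less_dividend) auto
  ultimately show False by simp
qed

lemma pw_0: "pw G w s 0 y = 0 ^ y"
  by (simp add: pw_def)

lemma pw_std: "pw G w 0 x y = x ^ y"
  by (simp add: pw_def)

lemma nat_eq_by_ln: "x > 0 \<Longrightarrow> z > 0 \<Longrightarrow> ln (real x) = ln (real z) \<Longrightarrow> x = z" for x z :: nat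
  by (metis ln_inj_iff of_nat_0_less_iff of_nat_eq_iff)

text \<open>For positive x and y, a power equal to 1 forces \<open>lam x\<close> to vanish by
  \<open>lam_pw\<close>. This is a sum of two nonnegative terms, so x consists of primes of G and
  has phi(x) = 0; as weights are positive, x = 1.\<close>

lemma pw_eq_1_iff:
  assumes "adm y s"
  shows "pw G w s x y = 1 \<longleftrightarrow> x = 1 \<or> y = 0"
proof -
  consider "x = 0" | "y = 0" | "x > 0" "y > 0" by auto
  then show ?thesis
  proof cases
    case 2
    then have "s = 0" using adm_0 assms by blast
    then show ?thesis using 2 by (auto simp: pw_std)
  next
    case 3
    have "x = 1" if "pw G w s x y = 1"
    proof -
      have "real y * lam x = 0" using lam_pw[OF 3(1) assms] that by simp
      then have "lam x = 0" using 3 by simp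
      moreover have "ln (real (part G x)) \<le> ln (real x)"
        using 3 part_dvd[OF 3(1)] by (auto intro: dvd_imp_le)
      moreover have "real (phi G w x) * ln (real G) / real D \<ge> 0" using G_gt_1 by simp
      ultimately have "ln (real (part G x)) = ln (real x)" "real (phi G w x) * ln (real G) / real D = 0"
        unfolding lam_def by linarith+
      then have x: "part G x = x" and "phi G w x = 0"
        using nat_eq_by_ln[of "part G x" x] 3 G_gt_1 D_gt_1 by auto
      have "multiplicity p x = 0" if "p \<in> prime_factors G" for p
        using \<open>phi G w x = 0\<close> w_pos[OF that] that by (auto simp: phi_def)
      then have "part G x = 1"
        unfolding part_def by (intro prod.neutral) auto
      then show ?thesis using x by simp
    qed
    moreover have "pw G w s 1 y = 1" by (simp add: pw_def)
    ultimately show ?thesis using 3 by auto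
  qed (auto simp: pw_0 power_0_left)
qed

lemma pw_1_right: "adm 1 0 \<and> pw G w 0 x 1 = x"
  by (simp add: pw_def adm_def)

lemma pw_add:
  assumes "adm y s" "adm z t" "adm (y + z) (s + t)"
  shows "pw G w (s + t) x (y + z) = pw G w s x y * pw G w t x z"
proof (cases "x = 0")
  case False
  then show ?thesis
    using assms pw_pos[of x] by (intro nat_eq_by_ln) (auto simp: ln_mult ln_pw algebra_simps)
qed (auto simp: pw_0 power_add)

lemma pw_mult:
  assumes "adm y s"
  shows "pw G w s (x * z) y = pw G w s x y * pw G w s z y"
proof (cases "x = 0 \<or> z = 0")
  case False
  then show ?thesis
    using assms pw_pos[of _ y s] by (intro nat_eq_by_ln) (auto simp: ln_mult ln_pw lam_mult algebra_simps)
next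
  case True
  then show ?thesis
    by (cases "y = 0") (use adm_0[of s] assms in \<open>auto simp: pw_0 pw_std\<close>)
qed

lemma pw_prod_list:
  assumes "adm y s"
  shows "pw G w s (prod_list xs) y = prod_list (map (\<lambda>x. pw G w s x y) xs)"
  by (induction xs) (use assms pw_eq_1_iff in \<open>auto simp: pw_mult\<close>)

text \<open>u is the ideal part of the product: y * z minus the product of the standard parts y - s
  and z - t. For positive x the logarithms agree by \<open>ln_pw\<close> and
  \<open>lam_pw\<close>.\<close>

lemma pw_pw:
  assumes "adm y s" "adm z t" "adm (y * z) u"
    "int u = int y * int z - (int y - int s) * (int z - int t)"
  shows "pw G w t (pw G w s x y) z = pw G w u x (y * z)"
proof (cases "x = 0")
  case False
  have "real_of_int (int u) = real_of_int (int y * int z - (int y - int s) * (int z - int t))"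
    using assms by simp
  then have u: "real u = real y * real z - (real y - real s) * (real z - real t)" by simp
  have "ln (real (pw G w t (pw G w s x y) z)) = (real z - t) * ((real y - s) * ln x + s * lam x) + t * (y * lam x)"
    using False assms pw_pos[of x] by (simp add: ln_pw lam_pw)
  also have "\<dots> = (real (y * z) - real u) * ln x + u * lam x" by (simp add: u algebra_simps)
  also have "\<dots> = ln (real (pw G w u x (y * z)))" using False assms by (simp add: ln_pw)
  finally show ?thesis using False assms pw_pos by (intro nat_eq_by_ln) auto
next
  case True
  consider "y = 0" | "z = 0" | "y > 0" "z > 0" by auto
  then show ?thesis
  proof cases
    case 1
    then show ?thesis using True pw_eq_1_iff assms by (auto simp: pw_0)
  qed (use True assms in \<open>auto simp: pw_0 power_0_left adm_0 pw_std pw_def\<close>)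
qed

text \<open>Division by \<open>part G x ^ s\<close> uses up only j of the s / D factors G^(phi(x));
  at least m remain, and phi(x) \<ge> 1 because a prime of G divides x. This places values of the
  exponential in the ideal.\<close>

lemma power_dvd_pw:
  assumes "x > 0" "adm y s" "s \<le> y + j" "j + m \<le> s div D" and "p \<in> prime_factors G" "p dvd x"
  shows "G ^ m dvd pw G w s x y"
proof -
  have "prime p" using assms in_prime_factors_imp_prime by blast
  then have "multiplicity p x > 0" using assms by (simp add: prime_multiplicity_gt_zero_iff)
  then have "w p * multiplicity p x \<ge> 1" using w_pos assms by fastforce
  also have "w p * multiplicity p x \<le> phi G w x"
    unfolding phi_def using assms by (intro member_le_sum) auto
  finally have phi: "phi G w x \<ge> 1" .
  obtain q where q: "x ^ y * G ^ (phi G w x * j) = part G x ^ s * q"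
    using part_power_dvd[of x s y j] assms by blast
  obtain n where n: "s div D = j + m + n" using assms le_iff_add by blast
  have "pw G w s x y * part G x ^ s = x ^ y * G ^ (phi G w x * (j + m + n))"
    using pw_mult_part[of x y s] assms n by simp
  also have "\<dots> = x ^ y * G ^ (phi G w x * j) * G ^ (phi G w x * (m + n))"
    by (simp add: power_add algebra_simps)
  finally have "pw G w s x y * part G x ^ s = q * G ^ (phi G w x * (m + n)) * part G x ^ s"
    unfolding q by (simp only: ac_simps)
  then have "pw G w s x y = q * G ^ (phi G w x * (m + n))"
    using zero_less_power[OF part_pos[of x], of s] by (metis mult_cancel2 less_irrefl)
  moreover have "m \<le> phi G w x * (m + n)" using phi by (cases "phi G w x") auto
  ultimately show ?thesis by (simp add: dvd_mult le_imp_power_dvd)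
qed

lemma pw_coprime:
  assumes "\<And>p. p \<in> prime_factors G \<Longrightarrow> \<not> p dvd x"
  shows "pw G w s x y = x ^ y"
proof -
  have "part G x = 1" "phi G w x = 0"
    using assms by (auto simp: part_def phi_def not_dvd_imp_multiplicity_0 intro!: prod.neutral)
  then show ?thesis by (simp add: pw_def)
qed

text \<open>All primes of x divide G, so x^(s + 1) / x^s leaves a single x, and the other factor
  depends on x only through phi(x). Hence the common factor in the Fermat equation.\<close>

lemma pw_of_dvd:
  assumes "x dvd G"
  shows "pw G w s x (Suc s) = x * G ^ (phi G w x * (s div D))"
proof -
  have "x > 0" using assms G_gt_1 by (auto intro: Nat.gr0I)
  then show ?thesis using part_of_dvd[OF assms] by (simp add: pw_def D_eq mult.assoc mult.left_commute)
qed

end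

section \<open>Ultrapower of the natural numbers\<close>

lemma ex_free_ultrafilter:
  "\<exists>F :: nat filter. F \<le> sequentially \<and> F \<noteq> bot \<and> (\<forall>P. eventually P F \<or> eventually (\<lambda>n. \<not> P n) F)"
proof -
  \<comment> \<open>A maximal family with infinite finite intersections is an ultrafilter; asking
    for infinite rather than nonempty intersections makes it free.\<close>
  define C where "C = {A :: nat set set. \<forall>X. finite X \<and> X \<subseteq> A \<longrightarrow> infinite (\<Inter>X)}"
  have "\<Union>K \<in> C" if K: "subset.chain C K" for K
    unfolding C_def
  proof (intro CollectI allI impI)
    fix X assume X: "finite X \<and> X \<subseteq> \<Union>K"
    show "infinite (\<Inter>X)"
    proof (cases "X = {}")
      case False
      then have "K \<noteq> {}" using X by auto
      then obtain A where "A \<in> K" "X \<subseteq> A"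
        using X K finite_subset_Union_chain[of X K C] by auto
      then show ?thesis using K X unfolding subset.chain_def C_def by auto
    qed auto
  qed
  from subset_Zorn'[OF this] obtain M where M: "M \<in> C" "\<And>A. A \<in> C \<Longrightarrow> M \<subseteq> A \<Longrightarrow> A = M" by blast
  have inf: "infinite (\<Inter>X)" if "finite X" "X \<subseteq> M" for X using M that by (auto simp: C_def)
  \<comment> \<open>By maximality, a set belongs to M once adding it leaves all finite intersections
    infinite.\<close>
  have mem: "S \<in> M" if "\<And>X. finite X \<Longrightarrow> X \<subseteq> M \<Longrightarrow> infinite (S \<inter> \<Inter>X)" for S
  proof -
    have "infinite (\<Inter>X)" if X: "finite X" "X \<subseteq> insert S M" for X
      using \<open>\<And>X. finite X \<Longrightarrow> X \<subseteq> M \<Longrightarrow> infinite (S \<inter> \<Inter>X)\<close>[of "X - {S}"] X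
      by (metis Diff_insert_absorb Inter_insert finite_Diff inf subset_insert_iff insert_Diff)
    then have "insert S M \<in> C" by (simp add: C_def)
    then show ?thesis using M(2) by blast
  qed
  have up: "T \<in> M" if "S \<in> M" "S \<subseteq> T" for S T
  proof (rule mem)
    fix X assume "finite X" "X \<subseteq> M"
    then have "infinite (\<Inter>(insert S X))" using that by (intro inf) auto
    then show "infinite (T \<inter> \<Inter>X)" by (rule contrapos_nn) (auto elim: rev_finite_subset intro: subsetD[OF that(2)])
  qed
  have int: "S \<inter> T \<in> M" if "S \<in> M" "T \<in> M" for S T
  proof (rule mem)
    fix X assume "finite X" "X \<subseteq> M"
    then have "infinite (\<Inter>(insert S (insert T X)))" using that by (intro inf) auto
    then show "infinite (S \<inter> T \<inter> \<Inter>X)" by (simp add: Int_assoc)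
  qed
  have compl: "S \<in> M \<or> - S \<in> M" for S
  proof (rule ccontr)
    assume a: "\<not> ?thesis"
    obtain X where X: "finite X" "X \<subseteq> M" "finite (S \<inter> \<Inter>X)" using mem[of S] a by blast
    obtain Y where Y: "finite Y" "Y \<subseteq> M" "finite (- S \<inter> \<Inter>Y)" using mem[of "- S"] a by blast
    have "finite ((S \<inter> \<Inter>X) \<union> (- S \<inter> \<Inter>Y))" using X Y by simp
    \<comment> \<open>The part of this intersection inside S is finite by the choice of X, the part
      outside S by the choice of Y.\<close>
    then have "finite (\<Inter>(X \<union> Y))" by (rule rev_finite_subset) auto
    then show False using inf[of "X \<union> Y"] X Y by simp
  qed
  define F where "F = Abs_filter (\<lambda>P. {n. P n} \<in> M)"
  have "is_filter (\<lambda>P. {n. P n} \<in> M)"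
  proof
    show "{n. True} \<in> M" using compl[of UNIV] inf[of "{{}}"] by auto
    show "{n. P n \<and> Q n} \<in> M" if "{n. P n} \<in> M" "{n. Q n} \<in> M" for P Q
      using int[OF that] by (simp add: Collect_conj_eq)
    show "{n. Q n} \<in> M" if "\<forall>n. P n \<longrightarrow> Q n" "{n. P n} \<in> M" for P Q
      using that by (intro up[OF that(2)]) auto
  qed
  then have ev: "eventually P F \<longleftrightarrow> {n. P n} \<in> M" for P
    unfolding F_def by (rule eventually_Abs_filter)
  have fin: "S \<notin> M" if "finite S" for S using inf[of "{S}"] that by auto
  have "eventually P F" if P: "eventually P sequentially" for P
  proof -
    obtain N where "\<And>n. n \<ge> N \<Longrightarrow> P n" using P by (auto simp: eventually_sequentially)
    then have "- {n. P n} \<subseteq> {..<N}" by (auto simp: not_le[symmetric])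
    then have "finite (- {n. P n})" by (rule finite_subset) simp
    then show ?thesis using compl[of "{n. P n}"] fin by (auto simp: ev)
  qed
  moreover have "F \<noteq> bot" using fin[of "{}"] by (auto simp: trivial_limit_def ev)
  moreover have "eventually P F \<or> eventually (\<lambda>n. \<not> P n) F" for P
    using compl[of "{n. P n}"] by (simp add: ev Collect_neg_eq)
  ultimately show ?thesis by (intro exI[of _ F]) (simp add: le_filter_def)
qed

definition \<U> :: "nat filter" where
  "\<U> = (SOME F. F \<le> sequentially \<and> F \<noteq> bot \<and> (\<forall>P. eventually P F \<or> eventually (\<lambda>n. \<not> P n) F))"

lemma U_props: "\<U> \<le> sequentially \<and> \<U> \<noteq> bot \<and> (\<forall>P. eventually P \<U> \<or> eventually (\<lambda>n. \<not> P n) \<U>)"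
  unfolding \<U>_def by (rule someI_ex) (rule ex_free_ultrafilter)

lemma U_sequentially: "eventually P sequentially \<Longrightarrow> eventually P \<U>"
  using U_props by (simp add: le_filter_def)

lemma U_ge: "\<forall>\<^sub>F n in \<U>. n \<ge> N"
  by (rule U_sequentially) (rule eventually_ge_at_top)

lemma U_False [simp]: "\<not> (\<forall>\<^sub>F n in \<U>. False)"
  using U_props by (simp add: trivial_limit_def)

lemma U_not: "(\<forall>\<^sub>F n in \<U>. \<not> P n) \<longleftrightarrow> \<not> (\<forall>\<^sub>F n in \<U>. P n)"
proof
  assume not: "\<forall>\<^sub>F n in \<U>. \<not> P n"
  show "\<not> (\<forall>\<^sub>F n in \<U>. P n)"
  proof
    assume "\<forall>\<^sub>F n in \<U>. P n"
    with not have "\<forall>\<^sub>F n in \<U>. False" by eventually_elim simp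
    then show False by simp
  qed
next
  assume "\<not> (\<forall>\<^sub>F n in \<U>. P n)"
  moreover have "(\<forall>\<^sub>F n in \<U>. P n) \<or> (\<forall>\<^sub>F n in \<U>. \<not> P n)" using U_props by simp
  ultimately show "\<forall>\<^sub>F n in \<U>. \<not> P n" by simp
qed

lemma U_const [simp]: "(\<forall>\<^sub>F n in \<U>. P) \<longleftrightarrow> P"
  by (cases P) auto

lemma U_disj: "(\<forall>\<^sub>F n in \<U>. P n \<or> Q n) \<longleftrightarrow> (\<forall>\<^sub>F n in \<U>. P n) \<or> (\<forall>\<^sub>F n in \<U>. Q n)"
  using U_not[of "\<lambda>n. \<not> P n \<and> \<not> Q n"] by (auto simp: eventually_conj_iff U_not)

lemma U_ex: "(\<forall>\<^sub>F n in \<U>. \<exists>a. P n a) \<longleftrightarrow> (\<exists>f. \<forall>\<^sub>F n in \<U>. P n (f n))"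
proof
  assume "\<forall>\<^sub>F n in \<U>. \<exists>a. P n a"
  then have "\<forall>\<^sub>F n in \<U>. P n (SOME a. P n a)" by eventually_elim (rule someI_ex)
  then show "\<exists>f. \<forall>\<^sub>F n in \<U>. P n (f n)" by (intro exI[of _ "\<lambda>n. SOME a. P n a"])
qed (auto elim: eventually_mono)

section \<open>Elements and operations of the ultrapower\<close>

definition rep :: "(nat \<Rightarrow> nat) \<Rightarrow> nat \<Rightarrow> nat" where
  "rep f = (SOME g. \<forall>\<^sub>F n in \<U>. f n = g n)"

text \<open>The class of a sequence modulo the ultrafilter is represented by the (encoded)
  graph of a chosen member, so that the universe consists of sets of natural numbers.\<close>
definition cls :: "(nat \<Rightarrow> nat) \<Rightarrow> nat set" where
  "cls f = range (\<lambda>n. prod_encode (n, rep f n))"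

lemma rep: "\<forall>\<^sub>F n in \<U>. f n = rep f n"
  unfolding rep_def by (rule someI[of _ f]) simp

lemma cls_eq_iff: "cls f = cls g \<longleftrightarrow> (\<forall>\<^sub>F n in \<U>. f n = g n)"
proof
  assume eq: "cls f = cls g"
  have reps: "rep f n = rep g n" for n
  proof -
    have "prod_encode (n, rep f n) \<in> cls f" unfolding cls_def by blast
    then have "prod_encode (n, rep f n) \<in> cls g" using eq by simp
    then show ?thesis by (auto simp: cls_def prod_encode_eq)
  qed
  show "\<forall>\<^sub>F n in \<U>. f n = g n" using rep[of f] rep[of g] by eventually_elim (simp add: reps)
next
  assume fg: "\<forall>\<^sub>F n in \<U>. f n = g n"
  have "(\<forall>\<^sub>F n in \<U>. f n = h n) \<longleftrightarrow> (\<forall>\<^sub>F n in \<U>. g n = h n)" for h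
    using fg by (auto elim: eventually_elim2)
  \<comment> \<open>Both representatives are chosen by the same predicate.\<close>
  then have "rep f = rep g" unfolding rep_def by simp
  then show "cls f = cls g" by (simp add: cls_def)
qed

definition seq :: "nat set \<Rightarrow> nat \<Rightarrow> nat" where
  "seq X = (SOME f. cls f = X)"

lemma cls_seq:
  assumes "X \<in> range cls"
  shows "cls (seq X) = X"
proof -
  obtain f where "X = cls f" using assms by (rule rangeE)
  then show ?thesis unfolding seq_def by (intro someI[of "\<lambda>f. cls f = X" f]) (rule sym)
qed

lemma seq_cls: "\<forall>\<^sub>F n in \<U>. seq (cls f) n = f n"
  using cls_seq[of "cls f"] cls_eq_iff by auto

definition upS :: "nat set lstr" where
  "upS = \<lparr>carr = range cls, zero_s = cls (\<lambda>_. 0), one_s = cls (\<lambda>_. 1),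
     plus_s = (\<lambda>X Y. cls (\<lambda>n. seq X n + seq Y n)), times_s = (\<lambda>X Y. cls (\<lambda>n. seq X n * seq Y n)),
     le_s = (\<lambda>X Y. \<forall>\<^sub>F n in \<U>. seq X n \<le> seq Y n)\<rparr>"

lemma upS_simps [simp]:
  "carr upS = range cls" "zero_s upS = cls (\<lambda>_. 0)" "one_s upS = cls (\<lambda>_. 1)"
  by (auto simp: upS_def)

lemma plus_cls [simp]: "plus_s upS (cls f) (cls g) = cls (\<lambda>n. f n + g n)"
  unfolding upS_def using seq_cls[of f] seq_cls[of g] by (auto simp: cls_eq_iff elim: eventually_elim2)

lemma times_cls [simp]: "times_s upS (cls f) (cls g) = cls (\<lambda>n. f n * g n)"
  unfolding upS_def using seq_cls[of f] seq_cls[of g] by (auto simp: cls_eq_iff elim: eventually_elim2)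

lemma le_cls [simp]: "le_s upS (cls f) (cls g) \<longleftrightarrow> (\<forall>\<^sub>F n in \<U>. f n \<le> g n)"
proof -
  have "\<forall>\<^sub>F n in \<U>. (seq (cls f) n \<le> seq (cls g) n) = (f n \<le> g n)"
    using seq_cls[of f] seq_cls[of g] by eventually_elim simp
  then show ?thesis unfolding upS_def by (auto elim: eventually_elim2)
qed

lemma lt_cls [simp]: "lt_s upS (cls f) (cls g) \<longleftrightarrow> (\<forall>\<^sub>F n in \<U>. f n < g n)"
  unfolding lt_s_def le_cls cls_eq_iff U_not[symmetric] eventually_conj_iff[symmetric]
  by (simp add: less_le)

lemma nmul_cls [simp]: "nmul upS k (cls f) = cls (\<lambda>n. k * f n)"
  unfolding nmul_def by (induction k) auto

lemma stdN_upS: "stdN upS = range (\<lambda>k. cls (\<lambda>_. k))"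
  by (simp add: stdN_def)

lemma is_lstr_upS: "is_lstr upS"
  by (auto simp: is_lstr_def)

section \<open>Transfer from the natural numbers to the ultrapower\<close>

lemma teval_cls: "teval upS (\<lambda>i. cls (v i)) t = cls (\<lambda>n. teval natS (\<lambda>i. v i n) t)"
  by (induction t) auto

text \<open>Los's theorem for a power of the standard model. P is left arbitrary because the result
  is also applied inside formulas interpreted with the predicate for standard numbers.\<close>

lemma los: "pure \<phi> \<Longrightarrow> sat upS P (\<lambda>i. cls (v i)) \<phi> \<longleftrightarrow> (\<forall>\<^sub>F n in \<U>. sat natS {} (\<lambda>i. v i n) \<phi>)"
proof (induction \<phi> arbitrary: v)
  case (Ex x \<phi>)
  have "sat upS P ((\<lambda>i. cls (v i))(x := cls f)) \<phi> \<longleftrightarrow>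
      (\<forall>\<^sub>F n in \<U>. sat natS {} ((\<lambda>i. v i n)(x := f n)) \<phi>)" for f
  proof -
    have *: "(\<lambda>i. cls (v i))(x := cls f) = (\<lambda>i. cls ((v(x := f)) i))" by (rule ext) simp
    have **: "(\<lambda>i. (v(x := f)) i n) = (\<lambda>i. v i n)(x := f n)" for n by (rule ext) simp
    show ?thesis using Ex.IH[of "v(x := f)"] Ex.prems unfolding * ** pure.simps by blast
  qed
  then show ?case by (simp add: U_ex)
next
  case (Neg \<phi>)
  then have "sat upS P (\<lambda>i. cls (v i)) \<phi> \<longleftrightarrow> (\<forall>\<^sub>F n in \<U>. sat natS {} (\<lambda>i. v i n) \<phi>)"
    by (intro Neg.IH) simp
  then show ?case by (simp only: sat.simps U_not)
next
  case (Conj \<phi> \<psi>)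
  have "sat upS P (\<lambda>i. cls (v i)) \<phi> \<longleftrightarrow> (\<forall>\<^sub>F n in \<U>. sat natS {} (\<lambda>i. v i n) \<phi>)"
    "sat upS P (\<lambda>i. cls (v i)) \<psi> \<longleftrightarrow> (\<forall>\<^sub>F n in \<U>. sat natS {} (\<lambda>i. v i n) \<psi>)"
    using Conj.prems by (simp_all only: Conj.IH pure.simps)
  then show ?case by (simp only: sat.simps eventually_conj_iff)
qed (simp_all add: teval_cls cls_eq_iff)

lemma env_cls:
  assumes "range w \<subseteq> carr upS"
  obtains v where "w = (\<lambda>i. cls (v i))"
proof (rule that, rule ext)
  fix i
  have "w i \<in> carr upS" using rangeI by (rule subsetD[OF assms])
  then show "w i = cls (seq (w i))" using cls_seq[of "w i"] by simp
qed

lemma models_upS: "models upS ThN"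
  unfolding models_def
proof (intro ballI allI impI)
  fix \<phi> and w :: "nat \<Rightarrow> nat set" assume \<phi>: "\<phi> \<in> ThN" and "range w \<subseteq> carr upS"
  then obtain v where w: "w = (\<lambda>i. cls (v i))" using env_cls by blast
  have ThN: "pure \<phi>" "fvars \<phi> = {}" "sat natS {} (\<lambda>_. 0) \<phi>" using \<phi> by (simp_all add: ThN_def)
  have "sat natS {} (\<lambda>i. v i n) \<phi> \<longleftrightarrow> sat natS {} (\<lambda>_. 0) \<phi>" for n
    by (rule sat_cong) (simp add: ThN(2))
  with ThN(3) have "sat natS {} (\<lambda>i. v i n) \<phi>" for n by blast
  then show "sat upS {} w \<phi>" unfolding w los[OF ThN(1)] by (intro always_eventually allI)
qed

lemma transfer_arithP:
  assumes "arithP P"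
  obtains \<phi> where "pure \<phi>" "\<And>Q v. sat upS Q (\<lambda>i. cls (v i)) \<phi> \<longleftrightarrow> (\<forall>\<^sub>F n in \<U>. P (\<lambda>i. v i n))"
proof -
  obtain \<phi> where "pure \<phi>" "\<forall>v. sat natS {} v \<phi> \<longleftrightarrow> P v" using assms by (auto simp: arithP_def)
  then show ?thesis by (intro that[of \<phi>]) (simp_all add: los)
qed

lemma asg_cls: "asg (map cls fs) (\<lambda>i. cls (w i)) = (\<lambda>i. cls (asg fs w i))"
  by (rule ext) (simp add: asg_def)

text \<open>\<open>ext\<close> picks some formula defining R in the standard model;
  \<open>arith_defines\<close> shows that there is one, and \<open>los\<close> evaluates it index by
  index.\<close>

lemma ext_upS:
  assumes "arithP (\<lambda>v. map v [0..<k] \<in> R)" "k > 0" "length fs = k"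
  shows "map cls fs \<in> ext upS k R \<longleftrightarrow> (\<forall>\<^sub>F n in \<U>. map (\<lambda>f. f n) fs \<in> R)"
proof -
  define \<phi> where "\<phi> = (SOME \<phi>. defines_in_N k R \<phi>)"
  have \<phi>: "defines_in_N k R \<phi>"
    unfolding \<phi>_def by (rule someI_ex) (rule arith_defines[OF assms(1,2)])
  have "asg (map (\<lambda>f. f n) fs) (\<lambda>_. 0) = (\<lambda>i. asg fs (\<lambda>_ _. 0) i n)" for n
    by (auto simp: asg_def)
  then have "sat natS {} (\<lambda>i. asg fs (\<lambda>_ _. 0) i n) \<phi> \<longleftrightarrow> map (\<lambda>f. f n) fs \<in> R" for n
    using \<phi> assms(3) unfolding defines_in_N_def by (metis length_map)
  moreover have "pure \<phi>" using \<phi> by (simp add: defines_in_N_def)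
  ultimately have "sat upS {} (asg (map cls fs) (\<lambda>_. zero_s upS)) \<phi> \<longleftrightarrow> (\<forall>\<^sub>F n in \<U>. map (\<lambda>f. f n) fs \<in> R)"
    using asg_cls[of fs "\<lambda>_ _. 0"] by (simp add: los)
  then show ?thesis using assms(3) by (auto simp: ext_def \<phi>_def)
qed

section \<open>Coded sets and sequences in the ultrapower\<close>

lemma mem_upS: "[cls f, cls g] \<in> ext upS 2 memN \<longleftrightarrow> (\<forall>\<^sub>F n in \<U>. f n \<in> set_decode (g n))"
  using ext_upS[OF arithP_memN, of "[f, g]"] by (simp add: memN_def set_decode_def)

lemma tup_upS: "[cls f, cls g, cls h] \<in> ext upS 3 (tupN 2) \<longleftrightarrow> (\<forall>\<^sub>F n in \<U>. h n = list_encode [f n, g n])"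
  using ext_upS[OF arithP_tupN, of "[f, g, h]"] by (simp add: tupN_2)

lemma len_upS: "[cls f, cls g] \<in> ext upS 2 lenN \<longleftrightarrow> (\<forall>\<^sub>F n in \<U>. g n = length (list_decode (f n)))"
  using ext_upS[OF arithP_lenN, of "[f, g]"] by (simp add: lenN_def)

lemma nth_upS: "[cls f, cls g, cls h] \<in> ext upS 3 nthN \<longleftrightarrow>
    (\<forall>\<^sub>F n in \<U>. h n = list_decode (f n) ! g n \<and> g n < length (list_decode (f n)))"
  using ext_upS[OF arithP_nthN, of "[f, g, h]"] by (simp add: nthN_def)

lemma prod_upS: "[cls f, cls g] \<in> ext upS 2 prodN \<longleftrightarrow> (\<forall>\<^sub>F n in \<U>. g n = prod_list (list_decode (f n)))"
  using ext_upS[OF arithP_prodN, of "[f, g]"] by (simp add: prodN_def)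

text \<open>At each index the graph below b n is a finite set, and the class of the codes of these
  sets is the required element. Provides (e7).\<close>

lemma coded_graph_upS:
  "coded_set upS 2 {[cls f, cls (\<lambda>n. h n (f n))] | f. \<forall>\<^sub>F n in \<U>. f n < b n}"
proof -
  define s where "s n = set_encode ((\<lambda>x. list_encode [x, h n x]) ` {..<b n})" for n
  have s: "c \<in> set_decode (s n) \<longleftrightarrow> (\<exists>x<b n. c = list_encode [x, h n x])" for c n
    unfolding s_def by (subst set_encode_inverse) auto
  have coded: "(\<exists>c. [cls f, cls g] @ [c] \<in> ext upS 3 (tupN 2) \<and> [c, cls s] \<in> ext upS 2 memN) \<longleftrightarrow>
      (\<forall>\<^sub>F n in \<U>. g n = h n (f n)) \<and> (\<forall>\<^sub>F n in \<U>. f n < b n)" for f g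
  proof
    assume "\<exists>c. [cls f, cls g] @ [c] \<in> ext upS 3 (tupN 2) \<and> [c, cls s] \<in> ext upS 2 memN"
    then obtain c where c: "[cls f, cls g, c] \<in> ext upS 3 (tupN 2)" "[c, cls s] \<in> ext upS 2 memN" by auto
    then have "c \<in> range cls" by (auto simp: ext_def)
    then obtain k where "c = cls k" by auto
    then have "\<forall>\<^sub>F n in \<U>. k n = list_encode [f n, g n]" "\<forall>\<^sub>F n in \<U>. k n \<in> set_decode (s n)"
      using c by (auto simp: tup_upS mem_upS)
    then have "\<forall>\<^sub>F n in \<U>. g n = h n (f n) \<and> f n < b n"
      by eventually_elim (auto simp: s prod_encode_eq)
    then show "(\<forall>\<^sub>F n in \<U>. g n = h n (f n)) \<and> (\<forall>\<^sub>F n in \<U>. f n < b n)"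
      by (simp add: eventually_conj_iff)
  next
    assume "(\<forall>\<^sub>F n in \<U>. g n = h n (f n)) \<and> (\<forall>\<^sub>F n in \<U>. f n < b n)"
    then have "\<forall>\<^sub>F n in \<U>. g n = h n (f n) \<and> f n < b n" by (simp add: eventually_conj_iff)
    then have "\<forall>\<^sub>F n in \<U>. list_encode [f n, g n] \<in> set_decode (s n)"
      by eventually_elim (auto simp: s)
    then have "[cls (\<lambda>n. list_encode [f n, g n]), cls s] \<in> ext upS 2 memN" by (simp add: mem_upS)
    moreover have "[cls f, cls g, cls (\<lambda>n. list_encode [f n, g n])] \<in> ext upS 3 (tupN 2)"
      by (simp add: tup_upS)
    ultimately show "\<exists>c. [cls f, cls g] @ [c] \<in> ext upS 3 (tupN 2) \<and> [c, cls s] \<in> ext upS 2 memN" by auto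
  qed
  have "{[cls f, cls (\<lambda>n. h n (f n))] | f. \<forall>\<^sub>F n in \<U>. f n < b n} = 
      {xs. length xs = 2 \<and> set xs \<subseteq> range cls \<and> 
        (\<exists>c. xs @ [c] \<in> ext upS 3 (tupN 2) \<and> [c, cls s] \<in> ext upS 2 memN)}" (is "?L = ?R")
  proof (rule subset_antisym; rule subsetI)
    fix xs assume "xs \<in> ?L"
    then obtain f where f: "xs = [cls f, cls (\<lambda>n. h n (f n))]" "\<forall>\<^sub>F n in \<U>. f n < b n" by blast
    then have "\<exists>c. xs @ [c] \<in> ext upS 3 (tupN 2) \<and> [c, cls s] \<in> ext upS 2 memN"
      unfolding f(1) coded by simp
    then show "xs \<in> ?R" unfolding f(1) by simp
  next
    fix xs assume xs: "xs \<in> ?R"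
    then obtain X Y where "xs = [X, Y]" by (auto simp: length_Suc_conv numeral_2_eq_2)
    with xs obtain f g where fg: "xs = [cls f, cls g]" by auto
    then have "(\<forall>\<^sub>F n in \<U>. g n = h n (f n)) \<and> (\<forall>\<^sub>F n in \<U>. f n < b n)"
      using xs coded[of f g] by simp
    then have "xs = [cls f, cls (\<lambda>n. h n (f n))]" "\<forall>\<^sub>F n in \<U>. f n < b n"
      using fg by (auto simp: cls_eq_iff)
    then show "xs \<in> ?L" by blast
  qed
  then show ?thesis
    unfolding coded_set_def by (intro bexI[of _ "cls s"]) (simp_all add: numeral_3_eq_3 numeral_2_eq_2)
qed

section \<open>A Fermat triple with balanced weights\<close>

lemma multiplicity_less:
  fixes p x :: nat
  assumes "prime p" "x > 0"
  shows "multiplicity p x < x"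
proof -
  have "multiplicity p x < 2 ^ multiplicity p x" by (rule less_exp)
  also have "\<dots> \<le> p ^ multiplicity p x" using prime_ge_2_nat[OF assms(1)] by (rule power_mono) simp
  also have "\<dots> \<le> x" using assms by (intro dvd_imp_le multiplicity_dvd)
  finally show ?thesis .
qed

text \<open>The weight to be given to a prime q exactly dividing x, all other primes dividing x having
  weight 1, so that the weights in x add up to G^3; see phi_bal. The cube makes the truncated
  difference positive.\<close>
definition bal :: "nat \<Rightarrow> nat \<Rightarrow> nat \<Rightarrow> nat" where
  "bal G q x = G ^ 3 - (\<Sum>p\<in>prime_factors G - {q}. multiplicity p x)"

text \<open>At most G primes divide G and each has multiplicity at most G in x, so the sum is at
  most G^2.\<close>

lemma sum_multiplicity_less:
  assumes "x dvd G" "G > 1" "A \<subseteq> prime_factors G"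
  shows "(\<Sum>p\<in>A. multiplicity p x) < G ^ 3"
proof -
  have x: "x > 0" "x \<le> G" using assms by (auto intro: dvd_imp_le Nat.gr0I)
  have "(\<Sum>p\<in>A. multiplicity p x) \<le> (\<Sum>p\<in>A. G)"
  proof (rule sum_mono)
    fix p assume "p \<in> A"
    then have "prime p" using assms in_prime_factors_imp_prime by blast
    from multiplicity_less[OF this x(1)] show "multiplicity p x \<le> G" using x by simp
  qed
  also have "\<dots> = card A * G" by simp
  also have "card A \<le> card {1..G}"
  proof (rule card_mono)
    show "A \<subseteq> {1..G}"
    proof
      fix p assume "p \<in> A"
      then have "prime p" "p dvd G" using assms(3) by (auto simp: in_prime_factors_iff)
      then show "p \<in> {1..G}" using assms(2) dvd_imp_le[of p G] prime_ge_1_nat[of p] by simp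
    qed
  qed simp
  then have "card A * G \<le> G * G" by simp
  also have "G * G < G ^ 3" using assms by (simp add: power3_eq_cube)
  finally show ?thesis .
qed

text \<open>q contributes \<open>bal G q x\<close> once, and the other primes contribute exactly
  what \<open>bal\<close> subtracts.\<close>

lemma phi_bal:
  assumes "q \<in> prime_factors G" "x dvd G" "G > 1" "multiplicity q x = 1" "w q = bal G q x"
    and "\<And>p. p \<in> prime_factors G \<Longrightarrow> p \<noteq> q \<Longrightarrow> w p = 1 \<or> multiplicity p x = 0"
  shows "phi G w x = G ^ 3"
proof -
  have "phi G w x = w q * multiplicity q x + (\<Sum>p\<in>prime_factors G - {q}. w p * multiplicity p x)"
    unfolding phi_def using assms(1) by (intro sum.remove) auto
  also have "(\<Sum>p\<in>prime_factors G - {q}. w p * multiplicity p x) = (\<Sum>p\<in>prime_factors G - {q}. multiplicity p x)"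
    using assms(6) by (intro sum.cong) fastforce+
  finally show ?thesis
    using assms sum_multiplicity_less[of x G "prime_factors G - {q}"] by (auto simp: bal_def)
qed

text \<open>For R coprime to 300 the power is 1 modulo 300 by Euler's theorem, so a is 2 and a + 3
  is 5 modulo 300 = 4 * 3 * 25. This controls how 2, 3 and 5 divide a and a + 3.\<close>

definition base :: "nat \<Rightarrow> nat" where
  "base R = 2 * R ^ totient 300"

definition radix :: "nat \<Rightarrow> nat" where
  "radix R = base R * 3 * (base R + 3)"

lemma base_mod:
  assumes "coprime R 300"
  shows "base R mod 300 = 2"
proof -
  have "[R ^ totient 300 = 1] (mod 300)" by (rule euler_theorem[OF assms])
  then have "[base R = 2 * 1] (mod 300)" unfolding base_def by (rule cong_scalar_left)
  then show ?thesis by (simp add: cong_def)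
qed

lemma multiplicity_eq_1:
  fixes p x :: nat
  shows "p dvd x \<Longrightarrow> \<not> p * p dvd x \<Longrightarrow> multiplicity p x = 1"
  by (rule multiplicity_eqI) simp_all

text \<open>Each of 2, 3, 5 divides exactly one of a, 3, a + 3, and only once. The weights at these
  primes can thus be set independently to give all three numbers the value G^3 under phi, and D is
  the sum 3 * G^3.\<close>

lemma balanced_weights:
  assumes R: "coprime R 300"
  defines "a \<equiv> base R" and "G \<equiv> radix R"
  defines "w \<equiv> wt (bal G 2 a, bal G 3 3, bal G 5 (a + 3))"
  shows "weights G w (3 * G ^ 3)" "phi G w a = G ^ 3" "phi G w 3 = G ^ 3" "phi G w (a + 3) = G ^ 3"
proof -
  have G: "G = a * 3 * (a + 3)" by (simp add: G_def a_def radix_def)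
  have amod: "a mod 300 = 2" unfolding a_def by (rule base_mod[OF R])
  have cmod: "(a + 3) mod 300 = 5" using mod_add_left_eq[of a 300 3] amod by simp
  \<comment> \<open>For k dividing 300, divisibility by k can be read off the residues 2 and 5; k =
    4 and k = 25 exclude the squares of 2 and 5.\<close>
  have "k dvd a \<longleftrightarrow> k dvd 2" "k dvd a + 3 \<longleftrightarrow> k dvd 5" if "k dvd 300" for k
    using dvd_mod_iff[OF that, of a] dvd_mod_iff[OF that, of "a + 3"] by (simp_all only: amod cmod)
  from this[of 2] this[of 3] this[of 4] this[of 5] this[of 25]
  have a: "2 dvd a" "\<not> 4 dvd a" "\<not> 3 dvd a" "\<not> 5 dvd a"
    and c: "\<not> 2 dvd a + 3" "\<not> 3 dvd a + 3" "5 dvd a + 3" "\<not> 25 dvd a + 3"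
    by simp_all
  have a_pos: "a > 0" using amod by (intro Nat.gr0I) simp
  have p: "prime (2::nat)" "prime (3::nat)" "prime (5::nat)" by simp_all
  obtain k where "a = Suc k" using a_pos gr0_conv_Suc by blast
  then have "G = 12 + (15 * k + 3 * k * k)" by (simp add: G algebra_simps)
  then have G1: "G > 1" by simp
  have dvd: "a dvd G" "3 dvd G" "a + 3 dvd G" by (simp_all add: G)
  have pf: "2 \<in> prime_factors G" "3 \<in> prime_factors G" "5 \<in> prime_factors G"
    using G1 p a c dvd by (auto simp: in_prime_factors_iff intro: dvd_trans)
  have mult: "multiplicity 2 a = 1" "multiplicity 3 (3::nat) = 1" "multiplicity 5 (a + 3) = 1"
    using multiplicity_eq_1[of 2 a] multiplicity_eq_1[of 3 3] multiplicity_eq_1[of 5 "a + 3"] a c by simp_all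
  have mult0: "multiplicity 3 a = 0" "multiplicity 5 a = 0" "multiplicity 2 (3::nat) = 0" 
    "multiplicity 5 (3::nat) = 0" "multiplicity 2 (a + 3) = 0" "multiplicity 3 (a + 3) = 0"
    by (rule not_dvd_imp_multiplicity_0, use a c in simp)+
  show pa: "phi G w a = G ^ 3"
    by (rule phi_bal[OF pf(1) dvd(1) G1 mult(1)]) (auto simp: w_def wt_def mult0)
  show p3: "phi G w 3 = G ^ 3"
    by (rule phi_bal[OF pf(2) dvd(2) G1 mult(2)]) (auto simp: w_def wt_def mult0)
  show pc: "phi G w (a + 3) = G ^ 3"
    by (rule phi_bal[OF pf(3) dvd(3) G1 mult(3)]) (auto simp: w_def wt_def mult0)
  have bal: "bal G q x \<ge> 1" if "x dvd G" for q x
    using sum_multiplicity_less[OF that G1, of "prime_factors G - {q}"] by (auto simp: bal_def)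
  show "weights G w (3 * G ^ 3)"
  proof
    show "w p \<ge> 1" for p using bal dvd by (simp add: w_def wt_def)
    have "phi G w G = phi G w a + phi G w 3 + phi G w (a + 3)"
      unfolding G using a_pos by (subst phi_mult | simp)+
    then show "3 * G ^ 3 = phi G w G" by (simp add: pa p3 pc)
    show "3 * G ^ 3 > 1" using zero_less_power[of G 3] G1 by linarith
  qed (rule G1)
qed

text \<open>Gives a all primes up to n other than 2, 3 and 5, while staying coprime to 300.\<close>

definition rough :: "nat \<Rightarrow> nat" where
  "rough n = \<Prod>{i \<in> {1..n}. coprime i 300}"

definition \<a> :: "nat \<Rightarrow> nat" where "\<a> n = base (rough n)"

definition \<G> :: "nat \<Rightarrow> nat" where "\<G> n = radix (rough n)"

definition \<omega> :: "nat \<Rightarrow> nat \<times> nat \<times> nat" where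
  "\<omega> n = (bal (\<G> n) 2 (\<a> n), bal (\<G> n) 3 3, bal (\<G> n) 5 (\<a> n + 3))"

lemma coprime_rough: "coprime (rough n) 300"
  unfolding rough_def by (rule prod_coprime_left) auto

interpretation W: weights "\<G> n" "wt (\<omega> n)" "3 * \<G> n ^ 3" for n
  unfolding \<omega>_def \<G>_def \<a>_def by (rule balanced_weights[OF coprime_rough])

lemma phi_triple:
  "phi (\<G> n) (wt (\<omega> n)) (\<a> n) = \<G> n ^ 3" "phi (\<G> n) (wt (\<omega> n)) 3 = \<G> n ^ 3"
  "phi (\<G> n) (wt (\<omega> n)) (\<a> n + 3) = \<G> n ^ 3"
  unfolding \<omega>_def \<G>_def \<a>_def by (rule balanced_weights[OF coprime_rough])+

lemma triple_dvd: "\<a> n dvd \<G> n" "3 dvd \<G> n" "\<a> n + 3 dvd \<G> n"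
  by (simp_all add: \<a>_def \<G>_def radix_def)

lemma dvd_rough: "coprime i 300 \<Longrightarrow> 1 \<le> i \<Longrightarrow> i \<le> n \<Longrightarrow> i dvd rough n"
  unfolding rough_def by (rule dvd_prodI) auto

lemma rough_dvd_a: "rough n dvd \<a> n"
  unfolding \<a>_def base_def by (intro dvd_mult dvd_power) simp

text \<open>300 * K + 1 is coprime to 300 and at most n, so it is a factor of \<open>rough n\<close>
  and divides the positive number \<open>\<a> n\<close>.\<close>

lemma a_ge: "n \<ge> 300 * K + 1 \<Longrightarrow> \<a> n > K"
proof -
  assume n: "n \<ge> 300 * K + 1"
  have "coprime (300 * K + 1) 300"
  proof (rule coprimeI)
    fix d assume "d dvd 300 * K + 1" "d dvd 300"
    then show "is_unit d" using dvd_add_right_iff[of d "300 * K" 1] by simp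
  qed
  then have "300 * K + 1 dvd rough n" using n by (intro dvd_rough) simp_all
  then have "300 * K + 1 dvd \<a> n" using rough_dvd_a by (rule dvd_trans)
  moreover have "\<a> n > 0" using base_mod[OF coprime_rough[of n]] unfolding \<a>_def by (intro Nat.gr0I) simp
  ultimately have "300 * K + 1 \<le> \<a> n" by (rule dvd_imp_le)
  then show ?thesis by simp
qed

text \<open>2 divides a, 3 is a factor of G, 5 divides a + 3; all other primes up to n divide
  \<open>rough n\<close>.\<close>

lemma prime_dvd_G:
  assumes "prime p" "p \<le> n"
  shows "p dvd \<G> n"
proof (cases "p dvd 300")
  case True
  have "(300::nat) = 2 * 2 * 3 * 5 * 5" by simp
  then have "p = 2 \<or> p = 3 \<or> p = 5"
    using True assms by (simp only: prime_dvd_mult_iff) (auto simp: primes_dvd_imp_eq)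
  moreover have amod: "\<a> n mod 300 = 2"
    unfolding \<a>_def by (rule base_mod[OF coprime_rough])
  have "2 dvd \<a> n"
    using amod dvd_mod_iff[of 2 300 "\<a> n"] by simp
  moreover have "(\<a> n + 3) mod 300 = 5" using mod_add_left_eq[of "\<a> n" 300 3] amod by simp
  then have "5 dvd \<a> n + 3" using dvd_mod_iff[of 5 300 "\<a> n + 3"] by simp
  ultimately show ?thesis
    using dvd_trans[OF _ triple_dvd(1)] triple_dvd(2) dvd_trans[OF _ triple_dvd(3)] by blast
next
  case False
  then have "coprime p 300" using assms by (simp add: prime_imp_coprime)
  then show ?thesis using assms dvd_rough rough_dvd_a triple_dvd(1) prime_ge_1_nat dvd_trans by meson
qed

lemma G_gt_1: "\<G> n > 1"
  by (rule W.G_gt_1)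

text \<open>A prime dividing k is at most n and so divides G; its multiplicity is less than k in k
  and at least k in G^k. This lets the ideal be divided by standard numbers.\<close>

lemma dvd_G_power:
  assumes "0 < k" "k \<le> n"
  shows "k dvd \<G> n ^ k"
proof (rule multiplicity_le_imp_dvd)
  fix q :: nat assume q: "prime q"
  show "multiplicity q k \<le> multiplicity q (\<G> n ^ k)"
  proof (cases "q dvd k")
    case True
    then have "q dvd \<G> n" using q assms by (intro prime_dvd_G) (auto dest: dvd_imp_le)
    then have "multiplicity q (\<G> n) \<ge> 1" using q G_gt_1[of n]
      by (simp add: Suc_le_eq prime_multiplicity_gt_zero_iff)
    moreover have "multiplicity q (\<G> n ^ k) = k * multiplicity q (\<G> n)"
      using q G_gt_1[of n] by (intro prime_elem_multiplicity_power_distrib) auto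
    moreover have "multiplicity q k < k" using q assms by (intro multiplicity_less)
    ultimately show ?thesis by (metis le_trans less_imp_le mult.right_neutral mult_le_mono2)
  qed (simp add: not_dvd_imp_multiplicity_0)
qed (use assms in auto)

lemma D_dvd: "3 * \<G> n ^ 3 dvd \<G> n ^ 4"
proof -
  have "\<G> n ^ 4 = \<G> n * \<G> n ^ 3" by (simp add: power3_eq_cube power4_eq_xxxx)
  then show ?thesis using triple_dvd(2)[of n] by (simp add: mult_dvd_mono)
qed

section \<open>The exponents\<close>

text \<open>The ideal I: as m is fixed before the set of indices, membership means divisibility by
  every standard power of G.\<close>

definition ideal_seq :: "(nat \<Rightarrow> int) \<Rightarrow> bool" where
  "ideal_seq \<sigma> \<longleftrightarrow> (\<forall>m. \<forall>\<^sub>F n in \<U>. int (\<G> n) ^ m dvd \<sigma> n)"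

lemma ideal_seq_0: "ideal_seq (\<lambda>_. 0)"
  by (simp add: ideal_seq_def)

lemma ideal_seq_add:
  assumes "ideal_seq \<sigma>" "ideal_seq \<tau>"
  shows "ideal_seq (\<lambda>n. \<sigma> n + \<tau> n)"
  unfolding ideal_seq_def
proof
  fix m
  from assms have "\<forall>\<^sub>F n in \<U>. int (\<G> n) ^ m dvd \<sigma> n" "\<forall>\<^sub>F n in \<U>. int (\<G> n) ^ m dvd \<tau> n"
    by (simp_all add: ideal_seq_def)
  then show "\<forall>\<^sub>F n in \<U>. int (\<G> n) ^ m dvd \<sigma> n + \<tau> n" by eventually_elim (rule dvd_add)
qed

lemma ideal_seq_mult:
  assumes "ideal_seq \<sigma>"
  shows "ideal_seq (\<lambda>n. \<tau> n * \<sigma> n)"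
  unfolding ideal_seq_def
proof
  fix m
  from assms have "\<forall>\<^sub>F n in \<U>. int (\<G> n) ^ m dvd \<sigma> n"
    by (simp add: ideal_seq_def)
  then show "\<forall>\<^sub>F n in \<U>. int (\<G> n) ^ m dvd \<tau> n * \<sigma> n" by eventually_elim (rule dvd_mult)
qed

lemma ideal_seq_diff: "ideal_seq \<sigma> \<Longrightarrow> ideal_seq \<tau> \<Longrightarrow> ideal_seq (\<lambda>n. \<sigma> n - \<tau> n)"
  using ideal_seq_add[of \<sigma> "\<lambda>n. - 1 * \<tau> n"] ideal_seq_mult[of \<tau> "\<lambda>_. - 1"] by simp

lemma ideal_seq_dvd: "ideal_seq \<sigma> \<Longrightarrow> \<forall>\<^sub>F n in \<U>. \<sigma> n dvd \<tau> n \<Longrightarrow> ideal_seq \<tau>"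
  unfolding ideal_seq_def by (auto elim: eventually_elim2 intro: dvd_trans)

lemma ideal_seq_power: "ideal_seq (\<lambda>n. int (\<G> n ^ n * f n))"
  unfolding ideal_seq_def
proof
  fix m
  show "\<forall>\<^sub>F n in \<U>. int (\<G> n) ^ m dvd int (\<G> n ^ n * f n)"
    using U_ge[of m] by eventually_elim (auto intro: dvd_mult2 le_imp_power_dvd)
qed

text \<open>With m = \<open>nat K\<close>, a nonzero multiple of G^m is at least 2^m in absolute
  value. So 0 is the only standard integer in the ideal, and decompositions of exponents are
  unique.\<close>

lemma ideal_seq_large:
  assumes "ideal_seq \<sigma>"
  shows "\<forall>\<^sub>F n in \<U>. \<sigma> n = 0 \<or> \<bar>\<sigma> n\<bar> > K"
proof -
  let ?m = "nat K"
  have "\<forall>\<^sub>F n in \<U>. int (\<G> n) ^ ?m dvd \<sigma> n" using assms by (simp add: ideal_seq_def)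
  then show ?thesis
  proof eventually_elim
    case (elim n)
    have "K < 2 ^ ?m" using of_nat_less_two_power[of ?m, where 'a = int] by linarith
    also have "\<dots> \<le> int (\<G> n) ^ ?m" using G_gt_1[of n] by (intro power_mono) auto
    finally have "K < int (\<G> n) ^ ?m" .
    moreover have "\<bar>int (\<G> n) ^ ?m\<bar> \<le> \<bar>\<sigma> n\<bar>" if "\<sigma> n \<noteq> 0" using that elim by (rule dvd_imp_le_int)
    ultimately show ?case by fastforce
  qed
qed

text \<open>The ideal part and the standard part of an exponent are integer sequences, since the
  standard part may be negative.\<close>
definition dec :: "(nat \<Rightarrow> nat) \<Rightarrow> (nat \<Rightarrow> int) \<Rightarrow> int \<Rightarrow> bool" where
  "dec Y \<sigma> \<kappa> \<longleftrightarrow> ideal_seq \<sigma> \<and> (\<forall>\<^sub>F n in \<U>. int (Y n) = \<sigma> n + \<kappa>)"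

definition expo :: "nat set set" where
  "expo = {cls Y | Y. \<exists>\<sigma> \<kappa>. dec Y \<sigma> \<kappa>}"

lemma dec_cong: "dec Y \<sigma> \<kappa> \<Longrightarrow> \<forall>\<^sub>F n in \<U>. Y n = Z n \<Longrightarrow> dec Z \<sigma> \<kappa>"
  unfolding dec_def by (auto elim: eventually_elim2)

lemma cls_in_expo: "cls Y \<in> expo \<longleftrightarrow> (\<exists>\<sigma> \<kappa>. dec Y \<sigma> \<kappa>)"
proof
  assume "cls Y \<in> expo"
  then obtain Z \<sigma> \<kappa> where "cls Y = cls Z" "dec Z \<sigma> \<kappa>" by (auto simp: expo_def)
  then have "dec Y \<sigma> \<kappa>" using dec_cong[of Z \<sigma> \<kappa> Y] by (auto simp: cls_eq_iff eq_commute)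
  then show "\<exists>\<sigma> \<kappa>. dec Y \<sigma> \<kappa>" by blast
qed (auto simp: expo_def)

text \<open>A negative ideal part would outweigh \<open>\<kappa>\<close> and make Y
  negative.\<close>

lemma dec_nonneg:
  assumes "dec Y \<sigma> \<kappa>"
  shows "\<forall>\<^sub>F n in \<U>. \<sigma> n \<ge> 0"
proof -
  have "\<forall>\<^sub>F n in \<U>. \<sigma> n = 0 \<or> \<bar>\<sigma> n\<bar> > \<bar>\<kappa>\<bar>" "\<forall>\<^sub>F n in \<U>. int (Y n) = \<sigma> n + \<kappa>"
    using assms by (auto simp: dec_def ideal_seq_large)
  then show ?thesis by eventually_elim linarith
qed

text \<open>The difference of the ideal parts lies in the ideal and is bounded by a standard
  number.\<close>

lemma dec_unique:
  assumes "dec Y \<sigma> \<kappa>" "dec Y \<sigma>' \<kappa>'"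
  shows "\<forall>\<^sub>F n in \<U>. \<sigma> n = \<sigma>' n"
proof -
  have "ideal_seq (\<lambda>n. \<sigma> n - \<sigma>' n)" using assms by (auto simp: dec_def intro: ideal_seq_diff)
  then have "\<forall>\<^sub>F n in \<U>. \<sigma> n - \<sigma>' n = 0 \<or> \<bar>\<sigma> n - \<sigma>' n\<bar> > \<bar>\<kappa>\<bar> + \<bar>\<kappa>'\<bar>" by (rule ideal_seq_large)
  moreover have "\<forall>\<^sub>F n in \<U>. int (Y n) = \<sigma> n + \<kappa>" "\<forall>\<^sub>F n in \<U>. int (Y n) = \<sigma>' n + \<kappa>'"
    using assms by (auto simp: dec_def)
  ultimately show ?thesis by eventually_elim linarith
qed

lemma dec_std: "dec (\<lambda>_. k) (\<lambda>_. 0) (int k)"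
  by (simp add: dec_def ideal_seq_0)

lemma dec_add:
  assumes "dec Y \<sigma> \<kappa>" "dec Z \<tau> l"
  shows "dec (\<lambda>n. Y n + Z n) (\<lambda>n. \<sigma> n + \<tau> n) (\<kappa> + l)"
proof -
  have "\<forall>\<^sub>F n in \<U>. int (Y n) = \<sigma> n + \<kappa>" "\<forall>\<^sub>F n in \<U>. int (Z n) = \<tau> n + l"
    using assms by (auto simp: dec_def)
  then have "\<forall>\<^sub>F n in \<U>. int (Y n + Z n) = \<sigma> n + \<tau> n + (\<kappa> + l)"
    by eventually_elim simp
  then show ?thesis using assms by (auto simp: dec_def intro: ideal_seq_add)
qed

lemma dec_diff: 
  assumes "dec Y \<sigma> \<kappa>" "dec Z \<tau> l" "\<forall>\<^sub>F n in \<U>. Z n \<le> Y n"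
  shows "dec (\<lambda>n. Y n - Z n) (\<lambda>n. \<sigma> n - \<tau> n) (\<kappa> - l)"
proof -
  have "\<forall>\<^sub>F n in \<U>. int (Y n) = \<sigma> n + \<kappa>" "\<forall>\<^sub>F n in \<U>. int (Z n) = \<tau> n + l"
    using assms by (auto simp: dec_def)
  then have "\<forall>\<^sub>F n in \<U>. int (Y n - Z n) = \<sigma> n - \<tau> n + (\<kappa> - l)"
    using assms(3) by eventually_elim simp
  then show ?thesis using assms by (auto simp: dec_def intro: ideal_seq_diff)
qed

text \<open>The ideal part is written as the product minus its standard part, the form that
  \<open>pw_pw\<close> asks for.\<close>

lemma dec_mult:
  assumes "dec Y \<sigma> \<kappa>" "dec Z \<tau> l"
  shows "dec (\<lambda>n. Y n * Z n) (\<lambda>n. (\<sigma> n + \<kappa>) * (\<tau> n + l) - \<kappa> * l) (\<kappa> * l)"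
proof -
  have "ideal_seq (\<lambda>n. \<tau> n * \<sigma> n + (l * \<sigma> n + \<kappa> * \<tau> n))"
    using assms by (intro ideal_seq_add ideal_seq_mult) (auto simp: dec_def)
  moreover have "(\<lambda>n. \<tau> n * \<sigma> n + (l * \<sigma> n + \<kappa> * \<tau> n)) = (\<lambda>n. (\<sigma> n + \<kappa>) * (\<tau> n + l) - \<kappa> * l)"
    by (simp add: algebra_simps)
  moreover have "\<forall>\<^sub>F n in \<U>. int (Y n) = \<sigma> n + \<kappa>" "\<forall>\<^sub>F n in \<U>. int (Z n) = \<tau> n + l"
    using assms by (auto simp: dec_def)
  then have "\<forall>\<^sub>F n in \<U>. int (Y n * Z n) = (\<sigma> n + \<kappa>) * (\<tau> n + l) - \<kappa> * l + \<kappa> * l"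
    by eventually_elim simp
  ultimately show ?thesis by (simp add: dec_def)
qed

text \<open>As k divides G^k, dividing \<open>\<sigma>\<close> by k is exact and stays in the ideal;
  rounding affects only \<open>\<kappa>\<close>.\<close>

lemma dec_div:
  assumes "dec Y \<sigma> \<kappa>" "k > 0"
  shows "dec (\<lambda>n. Y n div k) (\<lambda>n. \<sigma> n div int k) (\<kappa> div int k)"
proof -
  have *: "\<forall>\<^sub>F n in \<U>. int k * int (\<G> n) ^ m dvd \<sigma> n" for m
  proof -
    have "\<forall>\<^sub>F n in \<U>. int (\<G> n) ^ (k + m) dvd \<sigma> n" using assms by (simp add: dec_def ideal_seq_def)
    then show ?thesis using U_ge[of k]
    proof eventually_elim
      case (elim n)
      have "int k dvd int (\<G> n) ^ k" using dvd_G_power[of k n] elim assms by (metis int_dvd_int_iff of_nat_power)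
      then have "int k * int (\<G> n) ^ m dvd int (\<G> n) ^ (k + m)" by (simp add: power_add mult_dvd_mono)
      then show ?case using elim dvd_trans by blast
    qed
  qed
  have "ideal_seq (\<lambda>n. \<sigma> n div int k)"
    unfolding ideal_seq_def
  proof
    fix m
    show "\<forall>\<^sub>F n in \<U>. int (\<G> n) ^ m dvd \<sigma> n div int k"
      using *[of m] by eventually_elim (use assms in \<open>auto simp: dvd_def\<close>)
  qed
  moreover have "\<forall>\<^sub>F n in \<U>. int (Y n) = \<sigma> n + \<kappa>" using assms by (simp add: dec_def)
  then have "\<forall>\<^sub>F n in \<U>. int (Y n div k) = \<sigma> n div int k + \<kappa> div int k"
    using *[of 0] by eventually_elim (simp add: zdiv_int div_plus_div_distrib_dvd_left)
  ultimately show ?thesis by (simp add: dec_def)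
qed

text \<open>G^(4 + K) divides \<open>\<sigma>\<close>; D = 3 * G^3 divides G^4, and the remaining
  G^K keeps a nonzero quotient above K.\<close>

lemma dec_div_D:
  assumes "dec Y \<sigma> \<kappa>"
  shows "\<forall>\<^sub>F n in \<U>. 3 * \<G> n ^ 3 dvd nat (\<sigma> n) \<and> (\<sigma> n = 0 \<or> K \<le> nat (\<sigma> n) div (3 * \<G> n ^ 3))"
proof -
  have "\<forall>\<^sub>F n in \<U>. int (\<G> n) ^ (4 + K) dvd \<sigma> n" using assms by (simp add: dec_def ideal_seq_def)
  then show ?thesis using dec_nonneg[OF assms]
  proof eventually_elim
    case (elim n)
    have "3 * \<G> n ^ 3 * \<G> n ^ K dvd \<G> n ^ (4 + K)"
      unfolding power_add using D_dvd by (rule mult_dvd_mono) simp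
    also have "\<G> n ^ (4 + K) dvd nat (\<sigma> n)"
      using elim by (metis int_dvd_int_iff int_nat_eq of_nat_power)
    finally have dvd: "3 * \<G> n ^ 3 * \<G> n ^ K dvd nat (\<sigma> n)" .
    have "K \<le> nat (\<sigma> n) div (3 * \<G> n ^ 3)" if "\<sigma> n \<noteq> 0"
    proof -
      have "K < 2 ^ K" by (rule less_exp)
      also have "\<dots> \<le> \<G> n ^ K" using G_gt_1[of n] by (intro power_mono) auto
      also have "\<dots> = 3 * \<G> n ^ 3 * \<G> n ^ K div (3 * \<G> n ^ 3)" using G_gt_1[of n] by simp
      also have "\<dots> \<le> nat (\<sigma> n) div (3 * \<G> n ^ 3)"
        using dvd that elim by (intro div_le_mono dvd_imp_le) auto
      finally show ?thesis by simp
    qed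
    then show ?case using dvd dvd_mult_left by blast
  qed
qed

text \<open>s and y differ by a standard number, while s / D exceeds every standard number unless s
  = 0.\<close>

lemma dec_adm:
  assumes "dec Y \<sigma> \<kappa>"
  shows "\<forall>\<^sub>F n in \<U>. W.adm n (Y n) (nat (\<sigma> n))"
proof -
  have "\<forall>\<^sub>F n in \<U>. int (Y n) = \<sigma> n + \<kappa>" using assms by (simp add: dec_def)
  then show ?thesis using dec_div_D[OF assms, of "nat \<bar>\<kappa>\<bar>"] dec_nonneg[OF assms]
  proof eventually_elim
    case (elim n)
    then show ?case unfolding W.adm_def by linarith
  qed
qed

text \<open>The ideal part of the exponent is chosen; by \<open>dec_unique\<close> it is determined
  almost everywhere, so any decomposition gives the same value, see
  \<open>exp_up_cls\<close>.\<close>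

definition exp_up :: "nat set \<Rightarrow> nat set \<Rightarrow> nat set" where
  "exp_up X Y = cls (\<lambda>n. pw (\<G> n) (wt (\<omega> n)) (nat ((SOME \<sigma>. \<exists>\<kappa>. dec (seq Y) \<sigma> \<kappa>) n)) (seq X n) (seq Y n))"

lemma exp_up_cls:
  assumes "dec Y \<sigma> \<kappa>"
  shows "exp_up (cls f) (cls Y) = cls (\<lambda>n. pw (\<G> n) (wt (\<omega> n)) (nat (\<sigma> n)) (f n) (Y n))"
proof -
  define \<tau> where "\<tau> = (SOME \<sigma>. \<exists>\<kappa>. dec (seq (cls Y)) \<sigma> \<kappa>)"
  have Y: "\<forall>\<^sub>F n in \<U>. seq (cls Y) n = Y n" by (rule seq_cls)
  have "dec (seq (cls Y)) \<sigma> \<kappa>" using assms Y by (rule_tac dec_cong) (auto simp: eq_commute)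
  then have "\<exists>\<kappa>. dec (seq (cls Y)) \<tau> \<kappa>" unfolding \<tau>_def by (intro someI[of "\<lambda>\<sigma>. \<exists>\<kappa>. dec (seq (cls Y)) \<sigma> \<kappa>"]) auto
  then obtain l where "dec Y \<tau> l" using Y dec_cong by blast
  then have "\<forall>\<^sub>F n in \<U>. \<sigma> n = \<tau> n" using assms by (intro dec_unique)
  then show ?thesis unfolding exp_up_def cls_eq_iff \<tau>_def[symmetric]
    using Y seq_cls[of f] by eventually_elim simp
qed

abbreviation pwr :: "nat \<Rightarrow> nat \<Rightarrow> nat \<Rightarrow> nat \<Rightarrow> nat" where
  "pwr n \<equiv> pw (\<G> n) (wt (\<omega> n))"

lemma expoE:
  assumes "X \<in> expo"
  obtains Y \<sigma> \<kappa> where "X = cls Y" "dec Y \<sigma> \<kappa>"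
  using assms by (auto simp: expo_def)

lemma carrE:
  assumes "X \<in> carr upS"
  obtains f where "X = cls f"
  using assms by auto

lemma cls_expoI: "dec Y \<sigma> \<kappa> \<Longrightarrow> cls Y \<in> expo"
  unfolding cls_in_expo by (intro exI)

lemma expo_carr: "expo \<subseteq> carr upS"
  by (auto simp: expo_def)

section \<open>The exponents as a model of Presburger arithmetic\<close>

lemma substr_expo: "substr upS expo"
  unfolding substr_def
proof (intro conjI ballI)
  show "zero_s upS \<in> expo" "one_s upS \<in> expo"
    using dec_std[of 0] dec_std[of 1] by (auto simp: cls_in_expo)
next
  fix X Z assume "X \<in> expo" "Z \<in> expo"
  then obtain x \<sigma> k z \<tau> l where "X = cls x" "dec x \<sigma> k" "Z = cls z" "dec z \<tau> l"
    by (metis expoE)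
  then show "plus_s upS X Z \<in> expo" "times_s upS X Z \<in> expo"
    using dec_add[of x \<sigma> k z \<tau> l] dec_mult[of x \<sigma> k z \<tau> l] by (auto simp: cls_in_expo)
qed (rule expo_carr)

lemma presburger_expo: "presburger upS expo"
  unfolding presburger_def
proof (intro conjI ballI allI impI)
  fix X assume "X \<in> expo"
  then obtain x \<sigma> k where x: "X = cls x" "dec x \<sigma> k" by (rule expoE)
  show "zero_s upS \<noteq> plus_s upS X (one_s upS)" by (simp add: x cls_eq_iff)
  show "plus_s upS X (zero_s upS) = X" by (simp add: x)
  show "\<exists>Z\<in>expo. X = plus_s upS Z (one_s upS)" if "X \<noteq> zero_s upS"
  proof -
    have pos: "\<forall>\<^sub>F n in \<U>. 1 \<le> x n"
      using that unfolding x(1) upS_simps cls_eq_iff U_not[symmetric] by (rule eventually_mono) simp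
    then have "X = plus_s upS (cls (\<lambda>n. x n - 1)) (one_s upS)"
      by (auto simp: x cls_eq_iff elim: eventually_mono)
    moreover have "cls (\<lambda>n. x n - 1) \<in> expo"
      using dec_diff[OF x(2) dec_std[of 1] pos] by (auto simp: cls_in_expo)
    ultimately show ?thesis by blast
  qed
  show "\<exists>Z\<in>expo. le_s upS (nmul upS m Z) X \<and> lt_s upS X (nmul upS m (plus_s upS Z (one_s upS)))"
    if "m > 0" for m
  proof (rule bexI)
    have "m * (a div m) \<le> a" "a < m * (a div m + 1)" for a
      using that by (simp_all add: dividend_less_times_div)
    then show "le_s upS (nmul upS m (cls (\<lambda>n. x n div m))) X \<and>
        lt_s upS X (nmul upS m (plus_s upS (cls (\<lambda>n. x n div m)) (one_s upS)))"
      unfolding x(1) upS_simps plus_cls nmul_cls le_cls lt_cls by (intro conjI always_eventually allI) auto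
    show "cls (\<lambda>n. x n div m) \<in> expo"
      using dec_div[OF x(2) that] by (auto simp: cls_in_expo)
  qed
next
  fix X Z assume "X \<in> expo" "Z \<in> expo"
  then obtain x \<sigma> k z \<tau> l where xz: "X = cls x" "dec x \<sigma> k" "Z = cls z" "dec z \<tau> l"
    by (metis expoE)
  show "plus_s upS X Z = plus_s upS Z X" by (simp add: xz add.commute)
  show "le_s upS X Z \<longleftrightarrow> (\<exists>V\<in>expo. plus_s upS X V = Z)"
  proof
    assume "le_s upS X Z"
    then have le: "\<forall>\<^sub>F n in \<U>. x n \<le> z n" by (simp add: xz)
    then have "plus_s upS X (cls (\<lambda>n. z n - x n)) = Z"
      by (auto simp: xz cls_eq_iff elim: eventually_mono)
    moreover have "cls (\<lambda>n. z n - x n) \<in> expo"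
      using dec_diff[OF xz(4,2) le] by (auto simp: cls_in_expo)
    ultimately show "\<exists>V\<in>expo. plus_s upS X V = Z" by blast
  next
    assume "\<exists>V\<in>expo. plus_s upS X V = Z"
    then obtain v where "plus_s upS X (cls v) = Z" by (metis expoE)
    then have "\<forall>\<^sub>F n in \<U>. x n + v n = z n" by (simp add: xz cls_eq_iff)
    then have "\<forall>\<^sub>F n in \<U>. x n \<le> z n" by eventually_elim simp
    then show "le_s upS X Z" by (simp add: xz)
  qed
next
  fix X Z V assume "X \<in> expo" "Z \<in> expo" "V \<in> expo"
  then obtain x z v where xzv: "X = cls x" "Z = cls z" "V = cls v"
    by (metis expoE)
  show "plus_s upS (plus_s upS X Z) V = plus_s upS X (plus_s upS Z V)" by (simp add: xzv add.assoc)
  show "X = Z" if "plus_s upS X V = plus_s upS Z V"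
    using that by (simp add: xzv cls_eq_iff)
qed

section \<open>Verification of the exponential axioms\<close>

lemma exp_up_carr: "exp_up X Y \<in> carr upS"
  by (simp add: exp_up_def)

lemma exp_up_eq_1_iff:
  assumes "dec y \<sigma> k"
  shows "exp_up (cls x) (cls y) = one_s upS \<longleftrightarrow> cls x = one_s upS \<or> cls y = zero_s upS"
proof -
  have "\<forall>\<^sub>F n in \<U>. pwr n (nat (\<sigma> n)) (x n) (y n) = 1 \<longleftrightarrow> x n = 1 \<or> y n = 0"
    using dec_adm[OF assms] by eventually_elim (rule W.pw_eq_1_iff)
  then have "(\<forall>\<^sub>F n in \<U>. pwr n (nat (\<sigma> n)) (x n) (y n) = 1) \<longleftrightarrow> (\<forall>\<^sub>F n in \<U>. x n = 1 \<or> y n = 0)"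
    by (rule eventually_subst)
  then show ?thesis by (simp add: exp_up_cls[OF assms] cls_eq_iff U_disj)
qed

lemma exp_up_nonzero:
  assumes "dec y \<sigma> k" "cls x \<noteq> zero_s upS"
  shows "exp_up (cls x) (cls y) \<noteq> zero_s upS"
proof -
  have "\<forall>\<^sub>F n in \<U>. \<not> x n = 0" using assms(2) by (simp only: upS_simps cls_eq_iff U_not not_False_eq_True)
  then have "\<forall>\<^sub>F n in \<U>. \<not> pwr n (nat (\<sigma> n)) (x n) (y n) = 0"
    using dec_adm[OF assms(1)] by eventually_elim (use W.pw_pos in \<open>metis less_numeral_extra(3) neq0_conv\<close>)
  then show ?thesis unfolding exp_up_cls[OF assms(1)] upS_simps cls_eq_iff U_not .
qed

lemma exp_up_one: "exp_up (cls x) (one_s upS) = cls x"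
  unfolding upS_simps exp_up_cls[OF dec_std[of 1]] using W.pw_1_right by simp

lemma exp_up_add:
  assumes "dec y \<sigma> k" "dec z \<tau> l"
  shows "exp_up (cls x) (plus_s upS (cls y) (cls z)) = times_s upS (exp_up (cls x) (cls y)) (exp_up (cls x) (cls z))"
proof -
  note add = dec_add[OF assms]
  have "\<forall>\<^sub>F n in \<U>. pwr n (nat (\<sigma> n + \<tau> n)) (x n) (y n + z n) =
      pwr n (nat (\<sigma> n)) (x n) (y n) * pwr n (nat (\<tau> n)) (x n) (z n)"
    using dec_adm[OF assms(1)] dec_adm[OF assms(2)] dec_adm[OF add] dec_nonneg[OF assms(1)] dec_nonneg[OF assms(2)]
    by eventually_elim (simp add: nat_add_distrib W.pw_add)
  then show ?thesis by (simp add: exp_up_cls[OF assms(1)] exp_up_cls[OF assms(2)] exp_up_cls[OF add] cls_eq_iff)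
qed

lemma exp_up_mult:
  assumes "dec y \<sigma> k" "dec z \<tau> l"
  shows "exp_up (exp_up (cls x) (cls y)) (cls z) = exp_up (cls x) (times_s upS (cls y) (cls z))"
proof -
  note mult = dec_mult[OF assms]
  let ?u = "\<lambda>n. (\<sigma> n + k) * (\<tau> n + l) - k * l"
  have "\<forall>\<^sub>F n in \<U>. int (y n) = \<sigma> n + k" "\<forall>\<^sub>F n in \<U>. int (z n) = \<tau> n + l"
    using assms by (simp_all add: dec_def)
  then have "\<forall>\<^sub>F n in \<U>. pwr n (nat (\<tau> n)) (pwr n (nat (\<sigma> n)) (x n) (y n)) (z n) =
      pwr n (nat (?u n)) (x n) (y n * z n)"
    using dec_adm[OF assms(1)] dec_adm[OF assms(2)] dec_adm[OF mult]
      dec_nonneg[OF assms(1)] dec_nonneg[OF assms(2)] dec_nonneg[OF mult]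
  proof eventually_elim
    case (elim n)
    show ?case by (rule W.pw_pw) (use elim in simp_all)
  qed
  then show ?thesis
    by (simp add: exp_up_cls[OF assms(1)] exp_up_cls[OF assms(2)] exp_up_cls[OF mult] cls_eq_iff)
qed

text \<open>The hypothesis on entries concerns indices in the ultrapower. If entries disagreed at
  almost all n, chosen bad positions would form such an index and contradict it. So the lists agree
  entrywise almost everywhere, and \<open>pw_prod_list\<close> applies.\<close>

lemma exp_up_prod:
  assumes y: "dec y \<sigma> k"
    and len: "[cls s, cls l] \<in> ext upS 2 lenN" "[cls s', cls l] \<in> ext upS 2 lenN"
    and nth: "\<And>i x. lt_s upS (cls i) (cls l) \<Longrightarrow> [cls s, cls i, cls x] \<in> ext upS 3 nthN
          \<Longrightarrow> [cls s', cls i, exp_up (cls x) (cls y)] \<in> ext upS 3 nthN"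
    and prod: "[cls s, cls p] \<in> ext upS 2 prodN" "[cls s', cls p'] \<in> ext upS 2 prodN"
  shows "exp_up (cls p) (cls y) = cls p'"
proof -
  let ?L = "\<lambda>n. list_decode (s n)" and ?L' = "\<lambda>n. list_decode (s' n)"
  have len': "\<forall>\<^sub>F n in \<U>. l n = length (?L n)" "\<forall>\<^sub>F n in \<U>. l n = length (?L' n)"
    using len by (simp_all add: len_upS)
  have "\<forall>\<^sub>F n in \<U>. \<not> (\<exists>i. i < l n \<and> ?L' n ! i \<noteq> pwr n (nat (\<sigma> n)) (?L n ! i) (y n))"
    unfolding U_not U_ex
  proof
    assume "\<exists>i. \<forall>\<^sub>F n in \<U>. i n < l n \<and> ?L' n ! i n \<noteq> pwr n (nat (\<sigma> n)) (?L n ! i n) (y n)"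
    then obtain i where i: "\<forall>\<^sub>F n in \<U>. i n < l n"
      and neq: "\<forall>\<^sub>F n in \<U>. ?L' n ! i n \<noteq> pwr n (nat (\<sigma> n)) (?L n ! i n) (y n)"
      by (auto simp: eventually_conj_iff)
    define x where "x = (\<lambda>n. ?L n ! i n)"
    have "\<forall>\<^sub>F n in \<U>. x n = ?L n ! i n \<and> i n < length (?L n)"
      using i len'(1) by eventually_elim (simp add: x_def)
    then have "[cls s, cls i, cls x] \<in> ext upS 3 nthN" by (simp add: nth_upS)
    with nth i have "[cls s', cls i, exp_up (cls x) (cls y)] \<in> ext upS 3 nthN" by simp
    then have "\<forall>\<^sub>F n in \<U>. pwr n (nat (\<sigma> n)) (x n) (y n) = ?L' n ! i n \<and> i n < length (?L' n)"
      by (simp add: exp_up_cls[OF y] nth_upS)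
    with neq have "\<forall>\<^sub>F n in \<U>. False" by eventually_elim (simp add: x_def)
    then show False by simp
  qed
  then have "\<forall>\<^sub>F n in \<U>. ?L' n = map (\<lambda>x. pwr n (nat (\<sigma> n)) x (y n)) (?L n)"
    using len' by eventually_elim (auto intro!: nth_equalityI)
  moreover have "\<forall>\<^sub>F n in \<U>. p n = prod_list (?L n)" "\<forall>\<^sub>F n in \<U>. p' n = prod_list (?L' n)"
    using prod by (simp_all add: prod_upS)
  ultimately have "\<forall>\<^sub>F n in \<U>. pwr n (nat (\<sigma> n)) (p n) (y n) = p' n"
    using dec_adm[OF y] by eventually_elim (simp add: W.pw_prod_list)
  then show ?thesis by (simp add: exp_up_cls[OF y] cls_eq_iff)
qed

lemma exp_up_coded:
  assumes y: "dec y \<sigma> k"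
  shows "coded_set upS 2 {[x, exp_up x (cls y)] | x. x \<in> carr upS \<and> lt_s upS x (cls b)}"
proof -
  have "{[x, exp_up x (cls y)] | x. x \<in> carr upS \<and> lt_s upS x (cls b)} =
     {[cls f, cls (\<lambda>n. pwr n (nat (\<sigma> n)) (f n) (y n))] | f. \<forall>\<^sub>F n in \<U>. f n < b n}"
    using exp_up_cls[OF y] by auto
  then show ?thesis
    using coded_graph_upS[of "\<lambda>n x. pwr n (nat (\<sigma> n)) x (y n)" b] by simp
qed

lemma Exp_upS: "Exp upS expo exp_up"
  unfolding Exp_def
proof (intro conjI ballI)
  fix X assume "X \<in> carr upS"
  then obtain x where X: "X = cls x" by (rule carrE)
  show "exp_up X (one_s upS) = X" unfolding X by (rule exp_up_one)
  fix Y assume "Y \<in> expo"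
  then obtain y \<sigma> k where y: "Y = cls y" "dec y \<sigma> k" by (rule expoE)
  show "X = one_s upS \<or> Y = zero_s upS \<longleftrightarrow> exp_up X Y = one_s upS"
    using exp_up_eq_1_iff[OF y(2), of x] by (simp only: X y(1))
  show "X \<noteq> zero_s upS \<longrightarrow> exp_up X Y \<noteq> zero_s upS"
    unfolding X y(1) by (intro impI exp_up_nonzero[OF y(2)])
  show "coded_set upS 2 {[x, exp_up x Y] | x. x \<in> carr upS \<and> lt_s upS x X}"
    unfolding X y(1) by (rule exp_up_coded[OF y(2)])
  fix Z assume "Z \<in> expo"
  then obtain z \<tau> l where z: "Z = cls z" "dec z \<tau> l" by (rule expoE)
  show "exp_up X (plus_s upS Y Z) = times_s upS (exp_up X Y) (exp_up X Z)"
    unfolding X y(1) z(1) by (rule exp_up_add[OF y(2) z(2)])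
  show "exp_up (exp_up X Y) Z = exp_up X (times_s upS Y Z)"
    unfolding X y(1) z(1) by (rule exp_up_mult[OF y(2) z(2)])
next
  fix s l Y s' p p'
  assume mem: "s \<in> carr upS" "l \<in> carr upS" "Y \<in> expo" "s' \<in> carr upS" "p \<in> carr upS" "p' \<in> carr upS"
  obtain fs where s: "s = cls fs" using mem(1) by (rule carrE)
  obtain fl where l: "l = cls fl" using mem(2) by (rule carrE)
  obtain y \<sigma> k where y: "Y = cls y" "dec y \<sigma> k" using mem(3) by (rule expoE)
  obtain fs' where s': "s' = cls fs'" using mem(4) by (rule carrE)
  obtain fp where p: "p = cls fp" using mem(5) by (rule carrE)
  obtain fp' where p': "p' = cls fp'" using mem(6) by (rule carrE)
  show "[s, l] \<in> ext upS 2 lenN \<and> [s', l] \<in> ext upS 2 lenN \<and>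
        (\<forall>i\<in>carr upS. \<forall>x\<in>carr upS. lt_s upS i l \<and> [s, i, x] \<in> ext upS 3 nthN
            \<longrightarrow> [s', i, exp_up x Y] \<in> ext upS 3 nthN) \<and>
        [s, p] \<in> ext upS 2 prodN \<and> [s', p'] \<in> ext upS 2 prodN
        \<longrightarrow> exp_up p Y = p'"
    unfolding s l y(1) s' p p' upS_simps
    by (intro impI, elim conjE, rule exp_up_prod[OF y(2)]) blast+
qed (rule substr_expo presburger_expo exp_up_carr)+

section \<open>Closure of the exponents under exponentiation\<close>

lemma dec_power: "dec x \<sigma> k \<Longrightarrow> \<exists>\<tau> l. dec (\<lambda>n. x n ^ m) \<tau> l"
proof (induction m)
  case 0
  then show ?case using dec_std[of 1] by auto
next
  case (Suc m)
  then obtain \<tau> l where "dec (\<lambda>n. x n ^ m) \<tau> l" by blast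
  from dec_mult[OF Suc.prems this] show ?case by auto
qed

text \<open>A prime dividing k is standard, so it divides G almost everywhere, then the ideal part,
  then x. The case k = 0 is included, as every prime divides 0.\<close>

lemma coprime_kappa:
  assumes x: "dec x \<sigma> k" and cop: "\<forall>\<^sub>F n in \<U>. \<forall>p\<in>prime_factors (\<G> n). \<not> p dvd x n"
  shows "k = 1 \<or> k = -1"
proof (rule ccontr)
  assume "\<not> ?thesis"
  then have "nat \<bar>k\<bar> \<noteq> 1" by linarith
  then obtain p where p: "prime p" "p dvd nat \<bar>k\<bar>" using prime_factor_nat by blast
  then have "int p dvd int (nat \<bar>k\<bar>)" by (simp only: int_dvd_int_iff)
  then have pk: "int p dvd k" by simp
  have "\<forall>\<^sub>F n in \<U>. int (x n) = \<sigma> n + k" "\<forall>\<^sub>F n in \<U>. int (\<G> n) ^ 1 dvd \<sigma> n"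
    using x unfolding dec_def ideal_seq_def by blast+
  with cop U_ge[of p] have "\<forall>\<^sub>F n in \<U>. False"
  proof eventually_elim
    case (elim n)
    have pG: "p dvd \<G> n" using p(1) elim by (intro prime_dvd_G)
    then have "int p dvd \<sigma> n" using elim by (metis dvd_trans int_dvd_int_iff power_one_right)
    then have "int p dvd int (x n)" using elim pk by simp
    then have "p dvd x n" by simp
    moreover have "p \<in> prime_factors (\<G> n)" using p pG G_gt_1[of n] by (auto simp: in_prime_factors_iff)
    ultimately show False using elim by blast
  qed
  then show False by simp
qed

text \<open>The ultrafilter selects one of four cases. A standard exponent gives an iterated
  product; for a nonstandard one, x = 0 gives 0, and a positive x divisible by a prime of G gives a
  value in the ideal. If x is coprime to G, the value is x^y with standard part k^y, where k is 1 or
  -1.\<close>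

lemma exp_up_closed:
  assumes x: "dec x \<sigma> k" and y: "dec y \<tau> l"
  shows "exp_up (cls x) (cls y) \<in> expo"
proof -
  have "(\<forall>\<^sub>F n in \<U>. \<tau> n = 0) \<or> (\<forall>\<^sub>F n in \<U>. \<tau> n \<noteq> 0 \<and> x n = 0) \<or>
      (\<forall>\<^sub>F n in \<U>. \<tau> n \<noteq> 0 \<and> x n > 0 \<and> (\<exists>p\<in>prime_factors (\<G> n). p dvd x n)) \<or>
      (\<forall>\<^sub>F n in \<U>. \<forall>p\<in>prime_factors (\<G> n). \<not> p dvd x n)"
    unfolding U_disj[symmetric] by (intro always_eventually allI) auto
  then consider (std) "\<forall>\<^sub>F n in \<U>. \<tau> n = 0" | (zero) "\<forall>\<^sub>F n in \<U>. \<tau> n \<noteq> 0 \<and> x n = 0" |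
    (dvd) "\<forall>\<^sub>F n in \<U>. \<tau> n \<noteq> 0 \<and> x n > 0 \<and> (\<exists>p\<in>prime_factors (\<G> n). p dvd x n)" |
    (cop) "\<forall>\<^sub>F n in \<U>. \<forall>p\<in>prime_factors (\<G> n). \<not> p dvd x n" by blast
  then show ?thesis
  proof cases
    case std
    have "\<forall>\<^sub>F n in \<U>. int (y n) = \<tau> n + l" using y by (simp add: dec_def)
    with std have "\<forall>\<^sub>F n in \<U>. pwr n (nat (\<tau> n)) (x n) (y n) = x n ^ nat l"
    proof eventually_elim
      case (elim n)
      then have "y n = nat l" by simp
      with elim show ?case by (simp add: W.pw_std)
    qed
    then have "exp_up (cls x) (cls y) = cls (\<lambda>n. x n ^ nat l)" by (simp add: exp_up_cls[OF y] cls_eq_iff)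
    then show ?thesis using dec_power[OF x, of "nat l"] by (simp add: cls_in_expo)
  next
    case zero
    then have "\<forall>\<^sub>F n in \<U>. pwr n (nat (\<tau> n)) (x n) (y n) = 0"
      using dec_adm[OF y] dec_nonneg[OF y]
    proof eventually_elim
      case (elim n)
      have "y n \<noteq> 0"
      proof
        assume "y n = 0"
        with elim have "nat (\<tau> n) = 0" by (intro W.adm_0[of n]) simp
        with elim show False by simp
      qed
      then show ?case using elim by (simp add: W.pw_0)
    qed
    then have "exp_up (cls x) (cls y) = cls (\<lambda>n. 0)" by (simp add: exp_up_cls[OF y] cls_eq_iff)
    then show ?thesis using dec_std[of 0] by (auto simp: cls_in_expo)
  next
    case dvd
    have "ideal_seq (\<lambda>n. int (pwr n (nat (\<tau> n)) (x n) (y n)))"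
      unfolding ideal_seq_def
    proof
      fix m
      have "\<forall>\<^sub>F n in \<U>. int (y n) = \<tau> n + l" using y by (simp add: dec_def)
      \<comment> \<open>Of the factors counted by s / D, \<open>\<bar>l\<bar>\<close> make up for s
        - y and m are left over.\<close>
      with dvd show "\<forall>\<^sub>F n in \<U>. int (\<G> n) ^ m dvd int (pwr n (nat (\<tau> n)) (x n) (y n))"
        using dec_adm[OF y] dec_div_D[OF y, of "nat \<bar>l\<bar> + m"] dec_nonneg[OF y]
      proof eventually_elim
        case (elim n)
        then obtain p where "p \<in> prime_factors (\<G> n)" "p dvd x n" by blast
        then have "\<G> n ^ m dvd pwr n (nat (\<tau> n)) (x n) (y n)"
          using elim by (intro W.power_dvd_pw[where j = "nat \<bar>l\<bar>" and p = p]) auto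
        then show ?case by (metis int_dvd_int_iff of_nat_power)
      qed
    qed
    then have "dec (\<lambda>n. pwr n (nat (\<tau> n)) (x n) (y n)) (\<lambda>n. int (pwr n (nat (\<tau> n)) (x n) (y n))) 0"
      by (simp add: dec_def)
    then show ?thesis unfolding exp_up_cls[OF y] by (rule cls_expoI)
  next
    case cop
    have k: "k = 1 \<or> k = -1" by (rule coprime_kappa[OF x cop])
    have pw: "\<forall>\<^sub>F n in \<U>. pwr n (nat (\<tau> n)) (x n) (y n) = x n ^ y n"
      using cop by eventually_elim (rule W.pw_coprime, blast)
    \<comment> \<open>The parity of y n may vary with n; the ultrafilter decides it.\<close>
    have sgn: "(\<forall>\<^sub>F n in \<U>. k ^ y n = 1) \<or> (\<forall>\<^sub>F n in \<U>. k ^ y n = -1)"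
      unfolding U_disj[symmetric] using k
      by (intro always_eventually allI) (auto simp: minus_one_power_iff split: if_splits)
    then obtain l' where l': "\<forall>\<^sub>F n in \<U>. k ^ y n = l'" by blast
    have "\<forall>\<^sub>F n in \<U>. int (x n) = \<sigma> n + k" using x by (simp add: dec_def)
    with l' have "\<forall>\<^sub>F n in \<U>. \<sigma> n dvd int (x n ^ y n) - l'"
    proof eventually_elim
      case (elim n)
      have "[int (x n) = k] (mod \<sigma> n)" using elim by (simp add: cong_def)
      then have "[int (x n) ^ y n = k ^ y n] (mod \<sigma> n)" by (rule cong_pow)
      then show ?case using elim by (simp add: cong_iff_dvd_diff)
    qed
    moreover have "ideal_seq \<sigma>" using x by (simp add: dec_def)
    ultimately have "ideal_seq (\<lambda>n. int (x n ^ y n) - l')" by (rule ideal_seq_dvd[rotated])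
    then have "dec (\<lambda>n. x n ^ y n) (\<lambda>n. int (x n ^ y n) - l') l'"
      unfolding dec_def by (rule conjI) simp
    then have "cls (\<lambda>n. x n ^ y n) \<in> expo" by (rule cls_expoI)
    moreover have "exp_up (cls x) (cls y) = cls (\<lambda>n. x n ^ y n)"
      using pw by (simp add: exp_up_cls[OF y] cls_eq_iff)
    ultimately show ?thesis by simp
  qed
qed

section \<open>Definability of the exponential\<close>

lemma arithP_pw_graph:
  "arithP (\<lambda>v. v 2 = pw (v 3) (wt (v 4, v 5, v 6)) (v 7) (v 0) (v 1))"
  by (intro arithP_eq arithF_pw arithF_var)

text \<open>In the defining formulas variables 3 to 6 stand for G and the three weights, and 7 for the
  ideal part of the exponent.\<close>
definition params :: "nat \<Rightarrow> nat \<Rightarrow> nat" where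
  "params i n = (if i = 3 then \<G> n else if i = 4 then fst (\<omega> n) else 
     if i = 5 then fst (snd (\<omega> n)) else if i = 6 then snd (snd (\<omega> n)) else 0)"

lemma params_simps [simp]:
  "params 3 n = \<G> n" "(params 4 n, params 5 n, params 6 n) = \<omega> n"
  by (simp_all add: params_def)

text \<open>With y fixed, the ideal part and y itself become parameters; y sits in variable 2, since
  variables 0 and 1 hold the argument and the value.\<close>

lemma L_definable_exp_up:
  assumes y: "dec y \<sigma> k"
  shows "L_definable upS 2 {[x, exp_up x (cls y)] | x. x \<in> carr upS}"
proof -
  have "arithP (\<lambda>v. v 1 = pw (v 3) (wt (v 4, v 5, v 6)) (v 7) (v 0) (v 2))"
    by (intro arithP_eq arithF_pw arithF_var)
  then obtain \<phi> where \<phi>: "pure \<phi>" "\<And>Q v. sat upS Q (\<lambda>i. cls (v i)) \<phi> \<longleftrightarrow>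
      (\<forall>\<^sub>F n in \<U>. v 1 n = pw (v 3 n) (wt (v 4 n, v 5 n, v 6 n)) (v 7 n) (v 0 n) (v 2 n))"
    using transfer_arithP by blast
  define w where "w = params(7 := (\<lambda>n. nat (\<sigma> n)), 2 := y)"
  have "xs \<in> {[x, exp_up x (cls y)] | x. x \<in> carr upS} \<longleftrightarrow> sat upS {} (asg xs (\<lambda>i. cls (w i))) \<phi>"
    if l: "length xs = 2" "set xs \<subseteq> carr upS" for xs
  proof -
    obtain X Z where "xs = [X, Z]" using l by (auto simp: length_Suc_conv numeral_2_eq_2)
    with l obtain f g where xs: "xs = map cls [f, g]" by auto
    have "sat upS {} (asg xs (\<lambda>i. cls (w i))) \<phi> \<longleftrightarrow> (\<forall>\<^sub>F n in \<U>. g n = pwr n (nat (\<sigma> n)) (f n) (y n))"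
      unfolding xs asg_cls \<phi>(2) by (simp add: asg_def w_def)
    also have "\<dots> \<longleftrightarrow> cls g = exp_up (cls f) (cls y)" by (simp add: exp_up_cls[OF y] cls_eq_iff)
    also have "\<dots> \<longleftrightarrow> xs \<in> {[x, exp_up x (cls y)] | x. x \<in> carr upS}" by (auto simp: xs)
    finally show ?thesis by simp
  qed
  moreover have "range (\<lambda>i. cls (w i)) \<subseteq> carr upS" by auto
  ultimately show ?thesis unfolding L_definable_def using \<phi>(1) by blast
qed

section \<open>Definability with a predicate for standard numbers\<close>

lemma sat_Ex_cls: 
  "sat upS Q (\<lambda>i. cls (v i)) (fm.Ex x \<phi>) \<longleftrightarrow> (\<exists>f. sat upS Q (\<lambda>i. cls ((v(x := f)) i)) \<phi>)"
proof -
  have "(\<lambda>i. cls (v i))(x := cls f) = (\<lambda>i. cls ((v(x := f)) i))" for f by (rule ext) simp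
  then show ?thesis by simp
qed

lemma sat_Ex_std: 
  "sat upS (stdN upS) (\<lambda>i. cls (v i)) (fm.Ex x (Conj (Pred (Var x)) \<phi>)) \<longleftrightarrow> 
    (\<exists>k. sat upS (stdN upS) (\<lambda>i. cls ((v(x := (\<lambda>_. k))) i)) \<phi>)"
proof -
  have "(\<lambda>i. cls ((v(x := f)) i)) = (\<lambda>i. cls ((v(x := g)) i))" if "cls f = cls g" for f g
    using that by (intro ext) simp
  then have "sat upS Q (\<lambda>i. cls ((v(x := f)) i)) \<phi> \<longleftrightarrow> sat upS Q (\<lambda>i. cls ((v(x := g)) i)) \<phi>" 
    if "cls f = cls g" for f g Q using that by metis
  then show ?thesis
    unfolding sat_Ex_cls sat.simps(3,5) teval.simps(1) stdN_upS fun_upd_same by blast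
qed

text \<open>Replaces the decomposition of the exponent by quantifiers over an element s and over
  standard k and m, which the expanded language can express. The disjunction accounts for the sign
  of the standard part.\<close>

lemma standard_definition:
  "(\<exists>s. (\<forall>\<^sub>F n in \<U>. z n = pwr n (s n) (x n) (y n)) \<and>
      (\<exists>k. \<forall>\<^sub>F n in \<U>. y n = s n + k \<or> y n + k = s n) \<and> (\<forall>m. \<forall>\<^sub>F n in \<U>. \<G> n ^ m dvd s n)) \<longleftrightarrow>
    cls y \<in> expo \<and> cls z = exp_up (cls x) (cls y)" (is "?L \<longleftrightarrow> ?R")
proof
  assume ?L
  then obtain s k where s: "\<forall>\<^sub>F n in \<U>. z n = pwr n (s n) (x n) (y n)"
    "\<forall>\<^sub>F n in \<U>. y n = s n + k \<or> y n + k = s n" "\<forall>m. \<forall>\<^sub>F n in \<U>. \<G> n ^ m dvd s n" by blast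
  have "ideal_seq (\<lambda>n. int (s n))"
    using s(3) unfolding ideal_seq_def of_nat_power[symmetric] int_dvd_int_iff .
  moreover have "\<exists>l. \<forall>\<^sub>F n in \<U>. int (y n) = int (s n) + l"
    using s(2) unfolding U_disj
  proof
    assume "\<forall>\<^sub>F n in \<U>. y n = s n + k"
    then have "\<forall>\<^sub>F n in \<U>. int (y n) = int (s n) + int k" by eventually_elim simp
    then show ?thesis by blast
  next
    assume "\<forall>\<^sub>F n in \<U>. y n + k = s n"
    then have "\<forall>\<^sub>F n in \<U>. int (y n) = int (s n) + - int k" by eventually_elim simp
    then show ?thesis by blast
  qed
  ultimately obtain l where "dec y (\<lambda>n. int (s n)) l" by (auto simp: dec_def)
  then show ?R using s(1) by (auto simp: cls_in_expo exp_up_cls cls_eq_iff)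
next
  assume R: ?R
  then obtain \<sigma> k where y: "dec y \<sigma> k" by (auto simp: cls_in_expo)
  define s where "s = (\<lambda>n. nat (\<sigma> n))"
  have "\<forall>\<^sub>F n in \<U>. int (y n) = \<sigma> n + k" using y by (simp add: dec_def)
  then have 1: "\<forall>\<^sub>F n in \<U>. y n = s n + nat \<bar>k\<bar> \<or> y n + nat \<bar>k\<bar> = s n"
    using dec_nonneg[OF y] by eventually_elim (simp add: s_def, linarith)
  have 2: "\<forall>\<^sub>F n in \<U>. \<G> n ^ m dvd s n" for m
  proof -
    have "\<forall>\<^sub>F n in \<U>. int (\<G> n) ^ m dvd \<sigma> n" using y by (simp add: dec_def ideal_seq_def)
    then show ?thesis using dec_nonneg[OF y]
      by eventually_elim (metis int_dvd_int_iff int_nat_eq of_nat_power s_def)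
  qed
  have "\<forall>\<^sub>F n in \<U>. z n = pwr n (s n) (x n) (y n)"
    using R by (simp add: exp_up_cls[OF y] cls_eq_iff s_def)
  with 1 2 show ?L by blast
qed

lemma N_definable_exp_up: "N_definable upS 3 {[x, y, exp_up x y] | x y. x \<in> carr upS \<and> y \<in> expo}"
proof -
  obtain \<phi>1 where \<phi>1: "\<And>Q v. sat upS Q (\<lambda>i. cls (v i)) \<phi>1 \<longleftrightarrow>
      (\<forall>\<^sub>F n in \<U>. v 2 n = pw (v 3 n) (wt (v 4 n, v 5 n, v 6 n)) (v 7 n) (v 0 n) (v 1 n))"
    using transfer_arithP[OF arithP_pw_graph] by blast
  have "arithP (\<lambda>v. v 1 = v 7 + v 8 \<or> v 1 + v 8 = v 7)" by (intro arith_intros)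
  then obtain \<phi>2 where \<phi>2: "\<And>Q v. sat upS Q (\<lambda>i. cls (v i)) \<phi>2 \<longleftrightarrow>
      (\<forall>\<^sub>F n in \<U>. v 1 n = v 7 n + v 8 n \<or> v 1 n + v 8 n = v 7 n)"
    using transfer_arithP by blast
  have "arithP (\<lambda>v. v 3 ^ v 9 dvd v 7)" by (intro arithP_dvd arithF_power arithF_var)
  then obtain \<phi>3 where \<phi>3: "\<And>Q v. sat upS Q (\<lambda>i. cls (v i)) \<phi>3 \<longleftrightarrow> (\<forall>\<^sub>F n in \<U>. v 3 n ^ v 9 n dvd v 7 n)"
    using transfer_arithP by blast
  let ?std = "\<lambda>x \<phi>. fm.Ex x (Conj (Pred (Var x)) \<phi>)"
  \<comment> \<open>The two negations around variable 9 express quantification over all standard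
    m.\<close>
  define \<phi> where "\<phi> = fm.Ex 7 (Conj \<phi>1 (Conj (?std 8 \<phi>2) (Neg (?std 9 (Neg \<phi>3)))))"
  have "xs \<in> {[x, y, exp_up x y] | x y. x \<in> carr upS \<and> y \<in> expo} \<longleftrightarrow>
      sat upS (stdN upS) (asg xs (\<lambda>i. cls (params i))) \<phi>"
    if l: "length xs = 3" "set xs \<subseteq> carr upS" for xs
  proof -
    obtain X Y Z where "xs = [X, Y, Z]" using l by (auto simp: length_Suc_conv numeral_3_eq_3)
    with l obtain x y z where xs: "xs = map cls [x, y, z]" by auto
    have vals: "asg [x, y, z] params 0 = x" "asg [x, y, z] params 1 = y" "asg [x, y, z] params 2 = z"
      "asg [x, y, z] params 3 n = \<G> n" 
      "(asg [x, y, z] params 4 n, asg [x, y, z] params 5 n, asg [x, y, z] params 6 n) = \<omega> n" for n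
      by (simp_all add: asg_def)
    have "sat upS (stdN upS) (asg xs (\<lambda>i. cls (params i))) \<phi> \<longleftrightarrow>
       (\<exists>s. (\<forall>\<^sub>F n in \<U>. z n = pwr n (s n) (x n) (y n)) \<and>
      (\<exists>k. \<forall>\<^sub>F n in \<U>. y n = s n + k \<or> y n + k = s n) \<and> (\<forall>m. \<forall>\<^sub>F n in \<U>. \<G> n ^ m dvd s n))"
      unfolding xs asg_cls \<phi>_def sat_Ex_cls[where x = 7] sat.simps(4,5) sat_Ex_std \<phi>1 \<phi>2 \<phi>3
      by (simp add: vals vals(2)[simplified])
    also have "\<dots> \<longleftrightarrow> cls y \<in> expo \<and> cls z = exp_up (cls x) (cls y)" by (rule standard_definition)
    also have "\<dots> \<longleftrightarrow> xs \<in> {[x, y, exp_up x y] | x y. x \<in> carr upS \<and> y \<in> expo}" by (auto simp: xs)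
    finally show ?thesis by simp
  qed
  moreover have "range (\<lambda>i. cls (params i)) \<subseteq> carr upS" by auto
  ultimately show ?thesis unfolding N_definable_def by blast
qed

section \<open>The counterexamples to Fermat's Last Theorem\<close>

text \<open>Only positive members are taken, so that multipliers can be cancelled in
  \<open>lin_indepI\<close>.\<close>

definition ideal :: "nat set set" where
  "ideal = {cls z | z. ideal_seq (\<lambda>n. int (z n)) \<and> (\<forall>\<^sub>F n in \<U>. z n > 0)}"

lemma ideal_unbounded: "\<exists>z. cls z \<in> ideal \<and> (\<forall>n. d n < z n)"
proof -
  \<comment> \<open>The factor G^n puts z into the ideal; \<open>Suc (d n)\<close> keeps it positive
    and above d n.\<close>
  define z where "z = (\<lambda>n. \<G> n ^ n * Suc (d n))"
  have "d n < z n" for n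
  proof -
    have "1 * Suc (d n) \<le> z n"
      unfolding z_def using G_gt_1[of n] by (intro mult_right_mono) auto
    then show ?thesis by simp
  qed
  moreover from this have "\<forall>\<^sub>F n in \<U>. z n > 0" by (intro always_eventually allI) (metis gr_zeroI not_less_zero)
  then have "cls z \<in> ideal" unfolding ideal_def using ideal_seq_power[of "\<lambda>n. Suc (d n)"] by (auto simp: z_def)
  ultimately show ?thesis by blast
qed

text \<open>The factor z brings the components into the set of exponents and makes them
  large.\<close>

definition fermat_triples :: "(nat set \<times> nat set \<times> nat set) set" where
  "fermat_triples = {(cls (\<lambda>n. \<a> n * z n), cls (\<lambda>n. 3 * z n), cls (\<lambda>n. (\<a> n + 3) * z n)) | z. cls z \<in> ideal}"

text \<open>These have standard part 1, the case treated by \<open>pw_of_dvd\<close>.\<close>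

definition fermat_exponents :: "nat set set" where
  "fermat_exponents = {cls (\<lambda>n. Suc (z n)) | z. cls z \<in> ideal}"

lemma ideal_cls: "cls z \<in> ideal \<longleftrightarrow> ideal_seq (\<lambda>n. int (z n)) \<and> (\<forall>\<^sub>F n in \<U>. z n > 0)"
proof
  assume "cls z \<in> ideal"
  then obtain w where w: "\<forall>\<^sub>F n in \<U>. z n = w n" "ideal_seq (\<lambda>n. int (w n))" "\<forall>\<^sub>F n in \<U>. w n > 0"
    by (auto simp: ideal_def cls_eq_iff)
  have "ideal_seq (\<lambda>n. int (z n))"
    by (rule ideal_seq_dvd[OF w(2)]) (use w(1) in \<open>auto elim: eventually_mono\<close>)
  moreover have "\<forall>\<^sub>F n in \<U>. z n > 0" using w(1,3) by eventually_elim simp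
  ultimately show "ideal_seq (\<lambda>n. int (z n)) \<and> (\<forall>\<^sub>F n in \<U>. z n > 0)" by blast
qed (auto simp: ideal_def)

lemma fermat_exponents_expo: "fermat_exponents \<subseteq> expo"
proof
  fix X assume "X \<in> fermat_exponents"
  then obtain z where "X = cls (\<lambda>n. Suc (z n))" "ideal_seq (\<lambda>n. int (z n))"
    by (auto simp: fermat_exponents_def ideal_cls)
  moreover from this have "dec (\<lambda>n. Suc (z n)) (\<lambda>n. int (z n)) 1" by (simp add: dec_def)
  ultimately show "X \<in> expo" by (auto simp: cls_in_expo)
qed

lemma ideal_seq_expo: "ideal_seq (\<lambda>n. int (z n)) \<Longrightarrow> cls (\<lambda>n. c n * z n) \<in> expo"
  using ideal_seq_mult[of "\<lambda>n. int (z n)" "\<lambda>n. int (c n)"]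
  by (auto simp: cls_in_expo dec_def intro!: exI[of _ "\<lambda>n. int (c n) * int (z n)"] exI[of _ 0])

lemma fermat_triples_expo: "fermat_triples \<subseteq> expo \<times> expo \<times> expo"
  using ideal_seq_expo by (auto simp: fermat_triples_def ideal_cls)

text \<open>Multiplicativity splits off the power of z. As a, 3 and a + 3 divide G and agree under
  phi, \<open>pw_of_dvd\<close> gives them one factor q, and aq + 3q = (a + 3)q remains.\<close>

lemma fermat_equation:
  assumes "X \<in> fermat_exponents" "(A, B, C) \<in> fermat_triples"
  shows "plus_s upS (exp_up A X) (exp_up B X) = exp_up C X"
proof -
  obtain s where X: "X = cls (\<lambda>n. Suc (s n))" "ideal_seq (\<lambda>n. int (s n))"
    using assms(1) by (auto simp: fermat_exponents_def ideal_cls)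
  obtain z where ABC: "A = cls (\<lambda>n. \<a> n * z n)" "B = cls (\<lambda>n. 3 * z n)" "C = cls (\<lambda>n. (\<a> n + 3) * z n)"
    using assms(2) by (auto simp: fermat_triples_def)
  have dec: "dec (\<lambda>n. Suc (s n)) (\<lambda>n. int (s n)) 1" using X by (simp add: dec_def)
  have "\<forall>\<^sub>F n in \<U>. pwr n (s n) (\<a> n * z n) (Suc (s n)) + pwr n (s n) (3 * z n) (Suc (s n)) =
      pwr n (s n) ((\<a> n + 3) * z n) (Suc (s n))"
    using dec_adm[OF dec]
  proof eventually_elim
    case (elim n)
    then have "W.adm n (Suc (s n)) (s n)" by simp
    note mult = W.pw_mult[OF this]
    show ?case
      unfolding mult W.pw_of_dvd[OF triple_dvd(1)] W.pw_of_dvd[OF triple_dvd(2)]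
        W.pw_of_dvd[OF triple_dvd(3)] phi_triple
      by (simp only: distrib_right)
  qed
  then show ?thesis by (simp add: X ABC exp_up_cls[OF dec] cls_eq_iff)
qed

section \<open>Linear independence and unboundedness\<close>

lemma lin_indepI:
  assumes "cls z \<in> ideal" "\<And>k l. k \<noteq> 0 \<or> l \<noteq> 0 \<Longrightarrow> \<forall>\<^sub>F n in \<U>. k * c n \<noteq> l * d n"
  shows "lin_indep upS (cls (\<lambda>n. c n * z n)) (cls (\<lambda>n. d n * z n))"
  unfolding lin_indep_def
proof (intro notI, elim exE conjE)
  fix k l assume kl: "k \<noteq> 0 \<or> l \<noteq> 0" and "nmul upS k (cls (\<lambda>n. c n * z n)) = nmul upS l (cls (\<lambda>n. d n * z n))"
  then have "\<forall>\<^sub>F n in \<U>. k * (c n * z n) = l * (d n * z n)" by (simp add: cls_eq_iff)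
  moreover have "\<forall>\<^sub>F n in \<U>. z n > 0" using assms(1) by (simp add: ideal_cls)
  ultimately have "\<forall>\<^sub>F n in \<U>. False"
    using assms(2)[OF kl]
  proof eventually_elim
    case (elim n)
    then have "(k * c n) * z n = (l * d n) * z n" by (simp only: mult.assoc)
    then show False using elim by simp
  qed
  then show False by simp
qed

lemma a_large: "\<forall>\<^sub>F n in \<U>. \<a> n > K"
  using U_ge[of "300 * K + 1"] by eventually_elim (rule a_ge)

text \<open>After z is cancelled only a, 3 and a + 3 matter, and a exceeds every standard
  number.\<close>

lemma fermat_lin_indep:
  assumes "(A, B, C) \<in> fermat_triples"
  shows "lin_indep upS A B" "lin_indep upS A C" "lin_indep upS B C"
proof -
  obtain z where z: "cls z \<in> ideal"
    and ABC: "A = cls (\<lambda>n. \<a> n * z n)" "B = cls (\<lambda>n. 3 * z n)" "C = cls (\<lambda>n. (\<a> n + 3) * z n)"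
    using assms by (auto simp: fermat_triples_def)
  show "lin_indep upS A B"
    unfolding ABC using z
  proof (rule lin_indepI)
    fix k l :: nat assume kl: "k \<noteq> 0 \<or> l \<noteq> 0"
    show "\<forall>\<^sub>F n in \<U>. k * \<a> n \<noteq> l * 3"
      using a_large[of "3 * l"]
    proof eventually_elim
      case (elim n)
      show ?case
      proof (cases "k = 0")
        case False
        then have "\<a> n \<le> k * \<a> n" by simp
        then show ?thesis using elim by linarith
      qed (use kl in simp)
    qed
  qed
  show "lin_indep upS A C"
    unfolding ABC using z
  proof (rule lin_indepI)
    fix k l :: nat assume kl: "k \<noteq> 0 \<or> l \<noteq> 0"
    show "\<forall>\<^sub>F n in \<U>. k * \<a> n \<noteq> l * (\<a> n + 3)"
      using a_large[of "3 * l"]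
    proof eventually_elim
      case (elim n)
      show ?case
      \<comment> \<open>If k \<le> l, the summand 3 * l makes the right side larger; otherwise the
        additional a on the left exceeds 3 * l.\<close>
      proof (cases "k \<le> l")
        case True
        then have "k * \<a> n \<le> l * \<a> n" by simp
        moreover have "l > 0" using kl True by auto
        moreover have "l * (\<a> n + 3) = l * \<a> n + 3 * l" by (simp add: algebra_simps)
        ultimately show ?thesis by linarith
      next
        case False
        then have "(l + 1) * \<a> n \<le> k * \<a> n" by (intro mult_right_mono) auto
        then show ?thesis using elim by (auto simp: algebra_simps)
      qed
    qed
  qed
  show "lin_indep upS B C"
    unfolding ABC using z
  proof (rule lin_indepI)
    fix k l :: nat assume kl: "k \<noteq> 0 \<or> l \<noteq> 0"
    show "\<forall>\<^sub>F n in \<U>. k * 3 \<noteq> l * (\<a> n + 3)"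
      using a_large[of "3 * k"]
    proof eventually_elim
      case (elim n)
      show ?case
      proof (cases "l = 0")
        case False
        then have "\<a> n + 3 \<le> l * (\<a> n + 3)" by simp
        then show ?thesis using elim by linarith
      qed (use kl in simp)
    qed
  qed
qed

text \<open>A single multiplier z above d serves all three coordinates.\<close>

lemma fermat_triples_unbounded:
  "\<exists>A B C. (A, B, C) \<in> fermat_triples \<and> lt_s upS (cls d) A \<and> lt_s upS (cls d) B \<and> lt_s upS (cls d) C"
proof -
  obtain z where z: "cls z \<in> ideal" "\<And>n. d n < z n" using ideal_unbounded by blast
  have less: "d n < c * z n" if "c > 0" for c n
    using z(2)[of n] that by (metis less_le_trans mult_le_mono1 nat_mult_1 Suc_leI One_nat_def)
  have "lt_s upS (cls d) (cls (\<lambda>n. \<a> n * z n))"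
    unfolding lt_cls using a_large[of 0] by eventually_elim (rule less)
  moreover have "lt_s upS (cls d) (cls (\<lambda>n. 3 * z n))" "lt_s upS (cls d) (cls (\<lambda>n. (\<a> n + 3) * z n))"
    unfolding lt_cls by (intro always_eventually allI less, simp)+
  ultimately show ?thesis using z(1) unfolding fermat_triples_def by blast
qed

lemma fermat_exponents_unbounded: "\<exists>X\<in>fermat_exponents. lt_s upS (cls d) X"
proof -
  obtain z where z: "cls z \<in> ideal" "\<And>n. d n < z n" using ideal_unbounded by blast
  have "lt_s upS (cls d) (cls (\<lambda>n. Suc (z n)))"
    unfolding lt_cls using z(2) by (intro always_eventually allI) (rule less_SucI)
  then show ?thesis using z(1) unfolding fermat_exponents_def by blast
qed

theorem theorem4p8:
  shows "\<exists>(S :: nat set lstr) (A :: nat set set) (e :: nat set \<Rightarrow> nat set \<Rightarrow> nat set)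
            (E :: nat set set) (T :: (nat set \<times> nat set \<times> nat set) set).
    is_lstr S \<and> models S ThN \<and> Exp S A e \<and>
    E \<subseteq> A \<and> (\<forall>b\<in>carr S. \<exists>n\<in>E. lt_s S b n) \<and>
    T \<subseteq> carr S \<times> carr S \<times> carr S \<and>
    (\<forall>(a, b, c)\<in>T. lin_indep S a b \<and> lin_indep S a c \<and> lin_indep S b c) \<and>
    (\<forall>d\<in>carr S. \<exists>(a, b, c)\<in>T. lt_s S d a) \<and>
    (\<forall>d\<in>carr S. \<exists>(a, b, c)\<in>T. lt_s S d b) \<and>
    (\<forall>d\<in>carr S. \<exists>(a, b, c)\<in>T. lt_s S d c) \<and>
    (\<forall>n\<in>E. \<forall>(a, b, c)\<in>T. plus_s S (e a n) (e b n) = e c n) \<and>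
    (\<forall>y\<in>A. L_definable S 2 {[x, e x y] | x. x \<in> carr S}) \<and>
    N_definable S 3 {[x, y, e x y] | x y. x \<in> carr S \<and> y \<in> A} \<and>
    substr S A \<and> presburger S A \<and> (\<forall>x\<in>A. \<forall>y\<in>A. e x y \<in> A) \<and>
    T \<subseteq> A \<times> A \<times> A"
proof (rule exI[of _ upS], rule exI[of _ expo], rule exI[of _ exp_up], rule exI[of _ fermat_exponents],
    rule exI[of _ fermat_triples], intro conjI)
  show "\<forall>b\<in>carr upS. \<exists>n\<in>fermat_exponents. lt_s upS b n"
    using fermat_exponents_unbounded by (auto elim!: carrE simp del: upS_simps)
  show "fermat_triples \<subseteq> carr upS \<times> carr upS \<times> carr upS"
    using fermat_triples_expo expo_carr by blast
  show "\<forall>(a, b, c)\<in>fermat_triples. lin_indep upS a b \<and> lin_indep upS a c \<and> lin_indep upS b c"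
    using fermat_lin_indep by blast
  have "\<exists>A B C. (A, B, C) \<in> fermat_triples \<and> lt_s upS d A \<and> lt_s upS d B \<and> lt_s upS d C"
    if d: "d \<in> carr upS" for d
    using d fermat_triples_unbounded by (elim carrE) simp
  then show "\<forall>d\<in>carr upS. \<exists>(a, b, c)\<in>fermat_triples. lt_s upS d a"
    "\<forall>d\<in>carr upS. \<exists>(a, b, c)\<in>fermat_triples. lt_s upS d b"
    "\<forall>d\<in>carr upS. \<exists>(a, b, c)\<in>fermat_triples. lt_s upS d c"
    by blast+
  show "\<forall>n\<in>fermat_exponents. \<forall>(a, b, c)\<in>fermat_triples. plus_s upS (exp_up a n) (exp_up b n) = exp_up c n"
    using fermat_equation by blast
  show "\<forall>y\<in>expo. L_definable upS 2 {[x, exp_up x y] | x. x \<in> carr upS}"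
    using L_definable_exp_up by (blast elim: expoE)
  show "\<forall>x\<in>expo. \<forall>y\<in>expo. exp_up x y \<in> expo"
    using exp_up_closed by (blast elim: expoE)
qed (rule is_lstr_upS models_upS Exp_upS fermat_exponents_expo N_definable_exp_up substr_expo presburger_expo
    fermat_triples_expo)+

end
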